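(* Suppose $\psi$ is $\mu$-strongly convex with $\mu>0$ and the iterates $\boldsymbol{x}_1,\dots,\boldsymbol{x}_{T+1}$ are produced by the General Proximal Gradient Method under the Single Shuffle ($\mathsf{SS}$) sampling scheme, for arbitrary $T\in\mathbb{N}$, with stepsizes $\eta_t=\frac{m}{\mu t}$ for all $t\in[T]$, where $m\in\mathbb{N}$. Then for any $\boldsymbol{z}\in\mathbb{R}^d$, $$\mathbb{E}[F(\boldsymbol{x}_{T+1})-F(\boldsymbol{z})]\le O\left(\frac{\mu\|\boldsymbol{z}-\boldsymbol{x}_1\|^2}{\binom{m+T}{m}}+\frac{m(1+\log T)}{\mu}\left(\frac{\sqrt{n}\,G_{f,1}G_{f,2}}{T}+\frac{G_{f,1}G_{f,2}}{\sqrt{T}}+\frac{G_{f,2}^2}{n}\right)\right).$$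
   Context: Notation: $\mathbb{N}=\{1,2,\dots\}$, $[m]=\{1,\dots,m\}$, $\|\cdot\|$ and $\langle\cdot,\cdot\rangle$ are the Euclidean norm and inner product on $\mathbb{R}^d$, $\overline{\mathbb{R}}=(-\infty,+\infty]$, $\mathrm{dom}\,h=\{\boldsymbol{x}:h(\boldsymbol{x})<+\infty\}$, $\partial h(\boldsymbol{x})$ is the convex subdifferential and $\nabla h(\boldsymbol{x})$ denotes an element of $\partial h(\boldsymbol{x})$. $O(\cdot)$ hides an absolute constant. Problem: $F=f+\psi$ with $f=\frac1n\sum_{i=1}^n f_i$, each $f_i:\mathbb{R}^d\to\mathbb{R}$ convex, and $\psi:\mathbb{R}^d\to\overline{\mathbb{R}}$ proper, closed and convex. $\mu$-strong convexity of $\psi$ means $\psi(\boldsymbol{x})-\psi(\boldsymbol{y})-\langle\nabla\psi(\boldsymbol{y}),\boldsymbol{x}-\boldsymbol{y}\rangle\ge\frac\mu2\|\boldsymbol{x}-\boldsymbol{y}\|^2$ for all $\boldsymbol{x}\in\mathbb{R}^d$, $\boldsymbol{y}\in\mathrm{dom}\,\psi$ with $\partial\psi(\boldsymbol{y})\neq\varnothing$, and $\nabla\psi(\boldsymbol{y})\in\partial\psi(\boldsymbol{y})$. Each $f_i$ is $G_i$-Lipschitz on $\mathrm{dom}\,\psi$ for some $G_i>0$. For every $i\in[n]$ and $\boldsymbol{x}\in\mathbb{R}^d$, $\nabla f_i(\boldsymbol{x})$ is deterministically picked from $\partial f_i(\boldsymbol{x})$. Put $G_{f,1}=\frac1n\sum_{i=1}^nG_i$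 and $G_{f,2}=\sqrt{\frac1n\sum_{i=1}^nG_i^2}$. General Proximal Gradient Method: given an initial point $\boldsymbol{x}_1\in\mathrm{dom}\,\psi$ and stepsizes $\eta_t>0$, $t\in[T]$, for $t=1,\dots,T$ generate an index $\mathsf{i}(t)\in[n]$ and set $$\boldsymbol{x}_{t+1}=\mathrm{argmin}_{\boldsymbol{x}\in\mathbb{R}^d}\ \psi(\boldsymbol{x})+\langle\nabla f_{\mathsf{i}(t)}(\boldsymbol{x}_t),\boldsymbol{x}\rangle+\frac{\|\boldsymbol{x}-\boldsymbol{x}_t\|^2}{2\eta_t}.$$ For $t\in\mathbb{N}$, $\mathsf{r}(t)=t-(\lceil t/n\rceil-1)n\in[n]$. $\mathsf{SS}$ sampling scheme: $\mathsf{i}(t)=\pi^{\mathsf{r}(t)}$ where $\pi=(\pi^1,\dots,\pi^n)$ is a single uniformly random permutation of $[n]$.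
   Formalization: "G_i-Lipschitz on dom ψ" is read as also bounding the picked subgradients, ‖∇f_i(x)‖ ≤ G_i for x in dom ψ; with Lipschitz values alone the claim fails at boundary points of dom ψ. *)

theory Defs
  imports "HOL-Analysis.Analysis" "HOL-Probability.Probability_Mass_Function"
begin

section \<open>Euclidean spaces of all dimensions in one type\<close>

text \<open>
  The absolute constant hidden in an O-bound must not depend on the dimension, so the dimension
  has to be quantified inside a formula and cannot be a type. All spaces \<open>\<real>\<^sup>d\<close> are therefore
  realised inside one inner product space, the finitely supported real sequences, \<open>\<real>\<^sup>d\<close> being
  the subspace of the sequences supported on \<open>{..<d}\<close>.
\<close>

typedef fseq = "{c :: nat \<Rightarrow> real. finite {i. c i \<noteq> 0}}"
  morphisms coord Abs_fseq
  by (rule exI[of _ "\<lambda>_. 0"]) simp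

setup_lifting type_definition_fseq

lemma finite_support [simp]: "finite {i. coord x i \<noteq> 0}"
  using coord[of x] by simp

lemma fseq_eqI: "(\<And>i. coord x i = coord y i) \<Longrightarrow> x = y"
  by (simp add: coord_inject[symmetric] fun_eq_iff)

instantiation fseq :: real_vector
begin

lift_definition zero_fseq :: fseq is "\<lambda>_. 0" by simp

lift_definition plus_fseq :: "fseq \<Rightarrow> fseq \<Rightarrow> fseq" is "\<lambda>x y i. x i + y i"
  subgoal for x y
    by (rule finite_subset[of _ "{i. x i \<noteq> 0} \<union> {i. y i \<noteq> 0}"]) auto
  done

lift_definition minus_fseq :: "fseq \<Rightarrow> fseq \<Rightarrow> fseq" is "\<lambda>x y i. x i - y i"
  subgoal for x y
    by (rule finite_subset[of _ "{i. x i \<noteq> 0} \<union> {i. y i \<noteq> 0}"]) auto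
  done

lift_definition uminus_fseq :: "fseq \<Rightarrow> fseq" is "\<lambda>x i. - x i" by simp

lift_definition scaleR_fseq :: "real \<Rightarrow> fseq \<Rightarrow> fseq" is "\<lambda>a x i. a * x i"
  by (erule rev_finite_subset) auto

instance
  by standard (transfer, simp add: algebra_simps)+

end

lemmas coord_simps [simp] =
  zero_fseq.rep_eq plus_fseq.rep_eq minus_fseq.rep_eq uminus_fseq.rep_eq scaleR_fseq.rep_eq

instantiation fseq :: real_inner
begin

definition inner_fseq :: "fseq \<Rightarrow> fseq \<Rightarrow> real" where
  "inner_fseq x y = (\<Sum>i | coord x i \<noteq> 0. coord x i * coord y i)"

definition norm_fseq :: "fseq \<Rightarrow> real" where
  "norm_fseq x = sqrt (inner x x)"

definition sgn_fseq :: "fseq \<Rightarrow> fseq" where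
  "sgn_fseq x = x /\<^sub>R norm x"

definition dist_fseq :: "fseq \<Rightarrow> fseq \<Rightarrow> real" where
  "dist_fseq x y = norm (x - y)"

definition uniformity_fseq :: "(fseq \<times> fseq) filter" where
  "uniformity_fseq = (INF e\<in>{0<..}. principal {(x, y). dist x y < e})"

definition open_fseq :: "fseq set \<Rightarrow> bool" where
  "open_fseq U \<longleftrightarrow> (\<forall>x\<in>U. \<forall>\<^sub>F (x', y) in uniformity. x' = x \<longrightarrow> y \<in> U)"

lemma inner_fseq_superset:
  assumes "finite S" "{i. coord x i \<noteq> 0} \<subseteq> S"
  shows "inner x y = (\<Sum>i\<in>S. coord x i * coord y i)"
  unfolding inner_fseq_def using assms by (intro sum.mono_neutral_left) auto

instance
proof
  fix x y z :: fseq and r :: real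
  let ?S = "{i. coord x i \<noteq> 0} \<union> {i. coord y i \<noteq> 0} \<union> {i. coord z i \<noteq> 0}"
  have S: "finite ?S" by simp
  have I: "inner u v = (\<Sum>i\<in>?S. coord u i * coord v i)"
    if "{i. coord u i \<noteq> 0} \<subseteq> ?S" for u v
    using inner_fseq_superset[OF S that] .
  show "inner x y = inner y x"
  proof -
    have "inner x y = (\<Sum>i\<in>?S. coord x i * coord y i)" by (rule I) auto
    moreover have "inner y x = (\<Sum>i\<in>?S. coord y i * coord x i)" by (rule I) auto
    ultimately show ?thesis by (simp add: mult.commute)
  qed
  show "inner (x + y) z = inner x z + inner y z"
  proof -
    have "inner (x + y) z = (\<Sum>i\<in>?S. coord (x + y) i * coord z i)" by (rule I) auto
    moreover have "inner x z = (\<Sum>i\<in>?S. coord x i * coord z i)" by (rule I) auto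
    moreover have "inner y z = (\<Sum>i\<in>?S. coord y i * coord z i)" by (rule I) auto
    ultimately show ?thesis by (simp add: distrib_right sum.distrib)
  qed
  show "inner (scaleR r x) y = r * inner x y"
  proof -
    have "inner (scaleR r x) y = (\<Sum>i\<in>?S. coord (scaleR r x) i * coord y i)" by (rule I) auto
    moreover have "inner x y = (\<Sum>i\<in>?S. coord x i * coord y i)" by (rule I) auto
    ultimately show ?thesis by (simp add: sum_distrib_left mult.assoc)
  qed
  show "0 \<le> inner x x"
    by (simp add: inner_fseq_def sum_nonneg)
  show "inner x x = 0 \<longleftrightarrow> x = 0"
  proof
    assume "inner x x = 0"
    then have "\<forall>i\<in>{i. coord x i \<noteq> 0}. coord x i * coord x i = 0"
      by (subst (asm) inner_fseq_def, subst (asm) sum_nonneg_eq_0_iff) auto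
    then show "x = 0" by (intro fseq_eqI) auto
  qed (simp add: inner_fseq_def)
qed (rule norm_fseq_def sgn_fseq_def dist_fseq_def uniformity_fseq_def open_fseq_def)+

end

definition Rd :: "nat \<Rightarrow> fseq set" where
  "Rd d = {x. \<forall>i\<ge>d. coord x i = 0}"

lemma Rd_coordinates: "\<exists>!x. x \<in> Rd d \<and> (\<forall>i<d. coord x i = c i)"
proof
  let ?x = "Abs_fseq (\<lambda>i. if i < d then c i else 0)"
  have "finite {i. (if i < d then c i else 0) \<noteq> 0}"
    by (rule finite_subset[of _ "{..<d}"]) (auto split: if_splits)
  then have "coord ?x = (\<lambda>i. if i < d then c i else 0)"
    by (intro Abs_fseq_inverse) simp
  then show "?x \<in> Rd d \<and> (\<forall>i<d. coord ?x i = c i)"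
    by (simp add: Rd_def)
  show "y = ?x" if "y \<in> Rd d \<and> (\<forall>i<d. coord y i = c i)" for y
    using that \<open>coord ?x = _\<close> by (intro fseq_eqI) (auto simp: Rd_def)
qed

lemma inner_Rd:
  assumes "x \<in> Rd d"
  shows "inner x y = (\<Sum>i<d. coord x i * coord y i)"
  using assms by (intro inner_fseq_superset) (auto simp: Rd_def not_less[symmetric])

lemma norm_Rd:
  assumes "x \<in> Rd d"
  shows "norm x = sqrt (\<Sum>i<d. (coord x i)\<^sup>2)"
  using inner_Rd[OF assms, of x] by (simp add: norm_fseq_def power2_eq_square)

lemma subspace_Rd: "subspace (Rd d)"
  by (simp add: subspace_def Rd_def)


section \<open>Extended-real-valued convex functions on a subspace\<close>

text \<open>In all of the following \<open>E\<close> is the underlying space; values outside \<open>E\<close> play no role.\<close>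

definition effective_domain :: "'a set \<Rightarrow> ('a \<Rightarrow> ereal) \<Rightarrow> 'a set" where
  "effective_domain E h = {x \<in> E. h x < \<infinity>}"

definition epigraph_in :: "'a set \<Rightarrow> ('a \<Rightarrow> ereal) \<Rightarrow> ('a \<times> real) set" where
  "epigraph_in E h = {(x, r). x \<in> E \<and> h x \<le> ereal r}"

definition proper_closed_convex :: "'a::real_inner set \<Rightarrow> ('a \<Rightarrow> ereal) \<Rightarrow> bool" where
  "proper_closed_convex E h \<longleftrightarrow>
     (\<forall>x\<in>E. h x \<noteq> -\<infinity>) \<and> effective_domain E h \<noteq> {} \<and>
     closed (epigraph_in E h) \<and> convex (epigraph_in E h)"

definition subdifferential :: "'a::real_inner set \<Rightarrow> ('a \<Rightarrow> ereal) \<Rightarrow> 'a \<Rightarrow> 'a set" where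
  "subdifferential E h x = {g \<in> E. \<forall>y\<in>E. h x + ereal (inner g (y - x)) \<le> h y}"

definition strongly_convex :: "'a::real_inner set \<Rightarrow> real \<Rightarrow> ('a \<Rightarrow> ereal) \<Rightarrow> bool" where
  "strongly_convex E \<mu> h \<longleftrightarrow>
     (\<forall>x\<in>E. \<forall>y\<in>effective_domain E h. \<forall>g\<in>subdifferential E h y.
        h x - h y - ereal (inner g (x - y)) \<ge> ereal (\<mu> / 2 * (norm (x - y))\<^sup>2))"


section \<open>The proximal gradient method with single shuffling\<close>

definition objective :: "nat \<Rightarrow> (nat \<Rightarrow> 'a \<Rightarrow> real) \<Rightarrow> ('a \<Rightarrow> ereal) \<Rightarrow> 'a \<Rightarrow> ereal" where
  "objective n f \<psi> x = ereal (1 / real n * (\<Sum>i=1..n. f i x)) + \<psi> x"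

definition prox_gradient_iterates ::
  "'a::real_inner set \<Rightarrow> ('a \<Rightarrow> ereal) \<Rightarrow> (nat \<Rightarrow> 'a \<Rightarrow> 'a) \<Rightarrow> (nat \<Rightarrow> real) \<Rightarrow> (nat \<Rightarrow> nat) \<Rightarrow> nat
     \<Rightarrow> 'a \<Rightarrow> (nat \<Rightarrow> 'a) \<Rightarrow> bool" where
  "prox_gradient_iterates E \<psi> gf \<eta> idx T x1 x \<longleftrightarrow>
     x 1 = x1 \<and>
     (\<forall>t\<in>{1..T}. is_arg_min
        (\<lambda>y. \<psi> y + ereal (inner (gf (idx t) (x t)) y) + ereal ((norm (y - x t))\<^sup>2 / (2 * \<eta> t)))
        (\<lambda>y. y \<in> E) (x (Suc t)))"

definition epoch_pos :: "nat \<Rightarrow> nat \<Rightarrow> nat" where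
  "epoch_pos n t = nat (int t - (\<lceil>real t / real n\<rceil> - 1) * int n)"

definition random_permutation :: "nat \<Rightarrow> (nat \<Rightarrow> nat) pmf" where
  "random_permutation n = pmf_of_set {\<pi>. \<pi> permutes {1..n}}"

definition single_shuffle :: "nat \<Rightarrow> (nat \<Rightarrow> nat) \<Rightarrow> nat \<Rightarrow> nat" where
  "single_shuffle n \<pi> t = \<pi> (epoch_pos n t)"

text \<open>
  Expectation of an extended-real random variable as the difference of the integrals of its
  positive and negative parts; \<^const>\<open>e2ennreal\<close> sends negative arguments to 0.
\<close>

definition ereal_expectation :: "'b pmf \<Rightarrow> ('b \<Rightarrow> ereal) \<Rightarrow> ereal" where
  "ereal_expectation p X =
     enn2ereal (\<integral>\<^sup>+ w. e2ennreal (X w) \<partial>measure_pmf p)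
     - enn2ereal (\<integral>\<^sup>+ w. e2ennreal (- X w) \<partial>measure_pmf p)"

definition mean_G :: "nat \<Rightarrow> (nat \<Rightarrow> real) \<Rightarrow> real" where
  "mean_G n G = 1 / real n * (\<Sum>i=1..n. G i)"

definition rms_G :: "nat \<Rightarrow> (nat \<Rightarrow> real) \<Rightarrow> real" where
  "rms_G n G = sqrt (1 / real n * (\<Sum>i=1..n. (G i)\<^sup>2))"

text \<open>
  Lipschitz continuity on the effective domain includes the gradient bound
  \<open>\<parallel>\<nabla>f\<^sub>i(x)\<parallel> \<le> G\<^sub>i\<close> there. For the values of \<open>f\<^sub>i\<close> alone this would not follow at boundary points:
  \<open>f(x) = max 0 (-K x)\<close> vanishes on \<open>[0, \<infinity>)\<close> but has the subgradient \<open>-K\<close> at \<open>0\<close>.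
\<close>

definition lipschitz_with_gradient ::
  "real \<Rightarrow> 'a::real_inner set \<Rightarrow> ('a \<Rightarrow> real) \<Rightarrow> ('a \<Rightarrow> 'a) \<Rightarrow> bool" where
  "lipschitz_with_gradient G D h gh \<longleftrightarrow>
     G-lipschitz_on D h \<and> (\<forall>x\<in>D. norm (gh x) \<le> G)"

end

theory Submission
  imports Defs
begin

text \<open>
  Two ideas carry the proof: last-iterate convergence is reduced to averages over suffixes of the
  run, and the bias of sampling without replacement is controlled by algorithmic stability.

  A proximal step with index \<open>i\<close> decreases \<open>F\<close> relative to any reference point \<open>y\<close> up to an error of
  order \<open>\<eta>\<^sub>t (G\<^sub>f\<^sub>,\<^sub>1\<^sup>2 + G\<^sub>i\<^sup>2)\<close> and the noise terms \<open>(f - f\<^sub>i)(x\<^sub>t)\<close> and \<open>(f - f\<^sub>i)(y)\<close>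
  (\<open>prox_descent\<close>). With \<open>\<eta>\<^sub>t = m / (\<mu> t)\<close> the coefficients of the squared distances
  are \<open>\<mu> t / (2 m)\<close> and \<open>\<mu> (t + m) / (2 m)\<close>, so the distances telescope once step \<open>t\<close> is weighted by
  \<open>w\<^sub>t = (m + t - 1 choose t)\<close>, because \<open>(t + m) w\<^sub>t = (t + 1) w\<^bsub>t+1\<^esub>\<close>. These weights add up to
  \<open>(m + T choose m) - 1\<close>, which yields the first term of the bound. The descent inequality is used
  from time \<open>1\<close> with \<open>y = z\<close>, and from every later time \<open>k\<close> with \<open>y = x\<^sub>k\<close>, where the initial distance
  vanishes. Combining all these suffix estimates turns the bound on the weighted
  average into one on the last iterate, at the price of weighting the error of step \<open>t\<close> by
  \<open>1 / (T + 1 - t)\<close> (\<open>last_le_of_suffix_averages\<close>); this is the origin of the logarithm.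

  It remains to bound the expected noise \<open>(f - f\<^bsub>\<pi>(r)\<^esub>)(x\<^sub>k)\<close>, where \<open>x\<^sub>k\<close> depends on the permutation
  \<open>\<pi>\<close>. Exchanging the values of \<open>\<pi>\<close> at two positions \<open>r\<close> and \<open>j\<close> preserves the uniform distribution,
  so the mean of \<open>f\<^bsub>\<pi>(j)\<^esub>(x\<^sub>k(\<pi>))\<close> is the mean of \<open>f\<^bsub>\<pi>(r)\<^esub>\<close> at the iterate \<open>x\<^sub>k\<close> of the run with the
  exchanged permutation. By Lipschitz continuity the noise is thus at most the mean of
  \<open>G\<^bsub>\<pi>(r)\<^esub>\<close> times the distance between the two runs (\<open>perm_mean_swap_noise\<close>). Strong convexity
  makes each proximal step a contraction by the factor \<open>t / (t + m)\<close>, and a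
  subgradient step common to both runs increases the squared distance only by \<open>(2 \<eta>\<^sub>t G\<^sub>i)\<^sup>2\<close>, by
  monotonicity of the subdifferential. Hence these steps accumulate in a root of a sum of squares;
  only the two exchanged positions, visited about \<open>k / n + 1\<close> times each, contribute linearly
  (\<open>iterate_stability\<close>, \<open>swap_stability\<close>). Averaging over \<open>\<pi>\<close> and \<open>j\<close> gives noise of the
  order of \<open>m / \<mu> (\<surd>n G\<^sub>f\<^sub>,\<^sub>1 G\<^sub>f\<^sub>,\<^sub>2 / k + G\<^sub>f\<^sub>,\<^sub>1 G\<^sub>f\<^sub>,\<^sub>2 / \<surd>k + G\<^sub>f\<^sub>,\<^sub>2\<^sup>2 / n)\<close> (\<open>noise_bound\<close>).
\<close>

section \<open>Means over all permutations\<close>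

text \<open>
  A plain finite sum stands in for the expectation, since the objective is finite on all runs;
  \<open>ereal_expectation_random_permutation\<close> connects the two.
\<close>

definition perm_mean :: "nat \<Rightarrow> ((nat \<Rightarrow> nat) \<Rightarrow> real) \<Rightarrow> real" where
  "perm_mean n h = (\<Sum>\<pi> | \<pi> permutes {1..n}. h \<pi>) / fact n"

lemma card_permutes_fact: "card {\<pi>. \<pi> permutes {1..n}} = fact n"
  by (rule card_permutations) auto

lemma perm_mean_const: "perm_mean n (\<lambda>_. c) = c"
  unfolding perm_mean_def sum_constant card_permutes_fact by simp

lemma perm_mean_mono:
  assumes "\<And>\<pi>. \<pi> permutes {1..n} \<Longrightarrow> h \<pi> \<le> h' \<pi>"
  shows "perm_mean n h \<le> perm_mean n h'"
  unfolding perm_mean_def using assms by (intro divide_right_mono sum_mono) auto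

lemma perm_mean_cong:
  assumes "\<And>\<pi>. \<pi> permutes {1..n} \<Longrightarrow> h \<pi> = h' \<pi>"
  shows "perm_mean n h = perm_mean n h'"
  unfolding perm_mean_def using assms by simp

lemma perm_mean_add: "perm_mean n (\<lambda>\<pi>. h \<pi> + h' \<pi>) = perm_mean n h + perm_mean n h'"
  by (simp add: perm_mean_def sum.distrib add_divide_distrib)

lemma perm_mean_diff: "perm_mean n (\<lambda>\<pi>. h \<pi> - h' \<pi>) = perm_mean n h - perm_mean n h'"
  by (simp add: perm_mean_def sum_subtractf diff_divide_distrib)

lemma perm_mean_cmult: "perm_mean n (\<lambda>\<pi>. c * h \<pi>) = c * perm_mean n h"
  by (simp add: perm_mean_def sum_distrib_left[symmetric])

lemma perm_mean_abs_le:
  assumes "\<And>\<pi>. \<pi> permutes {1..n} \<Longrightarrow> \<bar>h \<pi>\<bar> \<le> h' \<pi>"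
  shows "\<bar>perm_mean n h\<bar> \<le> perm_mean n h'"
proof -
  have "perm_mean n h \<le> perm_mean n h'" "perm_mean n (\<lambda>\<pi>. -1 * h \<pi>) \<le> perm_mean n h'"
    using assms by (auto intro!: perm_mean_mono simp: abs_le_iff)
  then show ?thesis unfolding perm_mean_cmult by linarith
qed

lemma perm_mean_sum: "perm_mean n (\<lambda>\<pi>. \<Sum>j\<in>A. h j \<pi>) = (\<Sum>j\<in>A. perm_mean n (h j))"
  unfolding perm_mean_def by (subst sum.swap) (simp add: sum_divide_distrib)

lemma permutes_swap_comp:
  assumes "\<pi> permutes S" "a \<in> S" "b \<in> S"
  shows "\<pi> \<circ> Transposition.transpose a b permutes S"
  using assms by (intro permutes_compose permutes_swap_id)

text \<open>
  Composition with a fixed transposition is an involution on the permutations.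
\<close>

lemma perm_mean_swap:
  assumes "a \<in> {1..n}" "b \<in> {1..n}"
  shows "perm_mean n (\<lambda>\<pi>. h (\<pi> \<circ> Transposition.transpose a b)) = perm_mean n h"
proof -
  have inv: "(\<pi> \<circ> Transposition.transpose a b) \<circ> Transposition.transpose a b = \<pi>" for \<pi> :: "nat \<Rightarrow> nat"
    by (simp add: comp_assoc)
  have "(\<Sum>\<pi> | \<pi> permutes {1..n}. h (\<pi> \<circ> Transposition.transpose a b)) = (\<Sum>\<pi> | \<pi> permutes {1..n}. h \<pi>)"
    by (rule sum.reindex_bij_witness[where i = "\<lambda>\<pi>. \<pi> \<circ> Transposition.transpose a b"
          and j = "\<lambda>\<pi>. \<pi> \<circ> Transposition.transpose a b"])
      (use assms in \<open>auto simp only: inv mem_Collect_eq intro: permutes_swap_comp\<close>)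
  then show ?thesis by (simp add: perm_mean_def)
qed

lemma sum_perm:
  fixes h :: "nat \<Rightarrow> real"
  assumes "\<pi> permutes {1..n}"
  shows "(\<Sum>j=1..n. h (\<pi> j)) = (\<Sum>i=1..n. h i)"
  using sum.permute[OF assms, of h] by (simp add: comp_def)

text \<open>
  By exchangeability the mean is the same at every position, and the values at all positions add up
  to the sum over all indices whatever the permutation is.
\<close>

lemma perm_mean_at:
  assumes a: "a \<in> {1..n}"
  shows "perm_mean n (\<lambda>\<pi>. h (\<pi> a)) = (\<Sum>i=1..n. h i) / real n"
proof -
  have eq: "perm_mean n (\<lambda>\<pi>. h (\<pi> b)) = perm_mean n (\<lambda>\<pi>. h (\<pi> a))" if "b \<in> {1..n}" for b
    using perm_mean_swap[OF that a, of "\<lambda>\<pi>. h (\<pi> a)"] by simp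
  have "real n * perm_mean n (\<lambda>\<pi>. h (\<pi> a)) = (\<Sum>b=1..n. perm_mean n (\<lambda>\<pi>. h (\<pi> b)))"
    using eq by simp
  also have "\<dots> = perm_mean n (\<lambda>\<pi>. \<Sum>b=1..n. h (\<pi> b))"
    by (simp add: perm_mean_sum)
  also have "\<dots> = perm_mean n (\<lambda>_. \<Sum>i=1..n. h i)"
    by (rule perm_mean_cong) (rule sum_perm)
  finally show ?thesis using a by (simp add: perm_mean_const field_simps)
qed

text \<open>
  The full sum \<open>\<Sum>\<^sub>i f\<^sub>i(u(\<pi>))\<close> is rewritten as \<open>\<Sum>\<^sub>j f\<^bsub>\<pi>(j)\<^esub>(u(\<pi>))\<close>, and exchanging \<open>r\<close> and \<open>j\<close> moves
  each summand to position \<open>r\<close>. Both terms of the difference then involve the same function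
  \<open>f\<^bsub>\<pi>(r)\<^esub>\<close>, at two points that differ only through the exchange.
\<close>

lemma perm_mean_swap_noise:
  fixes f :: "nat \<Rightarrow> 'a::real_normed_vector \<Rightarrow> real"
  assumes r: "r \<in> {1..n}" and lip: "\<And>i. i \<in> {1..n} \<Longrightarrow> (G i)-lipschitz_on D (f i)"
    and u: "\<And>\<pi>. \<pi> permutes {1..n} \<Longrightarrow> u \<pi> \<in> D"
  shows "\<bar>perm_mean n (\<lambda>\<pi>. 1 / real n * (\<Sum>i=1..n. f i (u \<pi>)) - f (\<pi> r) (u \<pi>))\<bar>
    \<le> perm_mean n (\<lambda>\<pi>. 1 / real n * (\<Sum>j=1..n. G (\<pi> r) * norm (u (\<pi> \<circ> Transposition.transpose r j) - u \<pi>)))"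
    (is "\<bar>?L\<bar> \<le> ?R")
proof -
  have n: "real n > 0" using r by auto
  have "perm_mean n (\<lambda>\<pi>. \<Sum>i=1..n. f i (u \<pi>)) = perm_mean n (\<lambda>\<pi>. \<Sum>j=1..n. f (\<pi> j) (u \<pi>))"
    by (rule perm_mean_cong) (rule sum_perm[symmetric])
  also have "\<dots> = (\<Sum>j=1..n. perm_mean n (\<lambda>\<pi>. f (\<pi> j) (u \<pi>)))"
    by (rule perm_mean_sum)
  also have "\<dots> = (\<Sum>j=1..n. perm_mean n (\<lambda>\<pi>. f (\<pi> r) (u (\<pi> \<circ> Transposition.transpose r j))))"
  proof (rule sum.cong[OF refl])
    fix j assume "j \<in> {1..n}"
    then show "perm_mean n (\<lambda>\<pi>. f (\<pi> j) (u \<pi>))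
        = perm_mean n (\<lambda>\<pi>. f (\<pi> r) (u (\<pi> \<circ> Transposition.transpose r j)))"
      using perm_mean_swap[OF r, of j "\<lambda>\<pi>. f (\<pi> j) (u \<pi>)"] by simp
  qed
  finally have "?L = perm_mean n (\<lambda>\<pi>. 1 / real n *
      (\<Sum>j=1..n. f (\<pi> r) (u (\<pi> \<circ> Transposition.transpose r j)) - f (\<pi> r) (u \<pi>)))"
    using n by (simp add: perm_mean_diff perm_mean_cmult perm_mean_sum sum_subtractf
        perm_mean_const algebra_simps del: times_divide_eq_left)
  moreover have "\<bar>1 / real n * (\<Sum>j=1..n. f (\<pi> r) (u (\<pi> \<circ> Transposition.transpose r j)) - f (\<pi> r) (u \<pi>))\<bar>
      \<le> 1 / real n * (\<Sum>j=1..n. G (\<pi> r) * norm (u (\<pi> \<circ> Transposition.transpose r j) - u \<pi>))"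
    if \<pi>: "\<pi> permutes {1..n}" for \<pi>
  proof -
    have "\<bar>\<Sum>j=1..n. f (\<pi> r) (u (\<pi> \<circ> Transposition.transpose r j)) - f (\<pi> r) (u \<pi>)\<bar>
        \<le> (\<Sum>j=1..n. \<bar>f (\<pi> r) (u (\<pi> \<circ> Transposition.transpose r j)) - f (\<pi> r) (u \<pi>)\<bar>)"
      by (rule sum_abs)
    also have "\<dots> \<le> (\<Sum>j=1..n. G (\<pi> r) * norm (u (\<pi> \<circ> Transposition.transpose r j) - u \<pi>))"
    proof (rule sum_mono)
      fix j assume "j \<in> {1..n}"
      then show "\<bar>f (\<pi> r) (u (\<pi> \<circ> Transposition.transpose r j)) - f (\<pi> r) (u \<pi>)\<bar>
          \<le> G (\<pi> r) * norm (u (\<pi> \<circ> Transposition.transpose r j) - u \<pi>)"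
        using lipschitz_onD[OF lip u u, of "\<pi> r" "\<pi> \<circ> Transposition.transpose r j" \<pi>]
          permutes_swap_comp[OF \<pi> r] permutes_in_image[OF \<pi>] r \<pi>
        by (simp add: dist_norm)
    qed
    finally show ?thesis using n by (simp add: abs_mult divide_right_mono)
  qed
  ultimately show ?thesis by (simp only: perm_mean_abs_le)
qed

lemma ereal_expectation_random_permutation:
  assumes "\<And>\<pi>. \<pi> permutes {1..n} \<Longrightarrow> X \<pi> = ereal (h \<pi>)"
  shows "ereal_expectation (random_permutation n) X = ereal (perm_mean n h)"
proof -
  let ?S = "{\<pi>. \<pi> permutes {1..n}}"
  have S: "finite ?S" "?S \<noteq> {}" "id \<in> ?S"
    by (auto simp: finite_permutations intro: permutes_id)
  have int: "enn2ereal (\<integral>\<^sup>+ w. e2ennreal (Y w) \<partial>measure_pmf (random_permutation n))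
      = ereal (perm_mean n (\<lambda>\<pi>. max 0 (k \<pi>)))"
    if "\<And>\<pi>. \<pi> permutes {1..n} \<Longrightarrow> Y \<pi> = ereal (k \<pi>)" for Y k
  proof -
    have "(\<integral>\<^sup>+ w. e2ennreal (Y w) \<partial>measure_pmf (random_permutation n))
        = (\<Sum>\<pi>\<in>?S. e2ennreal (Y \<pi>)) / ennreal (fact n)"
      unfolding random_permutation_def nn_integral_pmf_of_set[OF S(2,1)] card_permutes_fact
      by (metis ennreal_of_nat_eq_real_of_nat of_nat_fact)
    also have "(\<Sum>\<pi>\<in>?S. e2ennreal (Y \<pi>)) = (\<Sum>\<pi>\<in>?S. ennreal (max 0 (k \<pi>)))"
      using that by (intro sum.cong) (auto simp: max_def ennreal_neg)
    also have "\<dots> = ennreal (\<Sum>\<pi>\<in>?S. max 0 (k \<pi>))"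
      by (rule sum_ennreal) simp
    also have "\<dots> / ennreal (fact n) = ennreal (perm_mean n (\<lambda>\<pi>. max 0 (k \<pi>)))"
      unfolding perm_mean_def by (rule divide_ennreal) (auto intro: sum_nonneg)
    finally show ?thesis
      by (simp add: perm_mean_def sum_nonneg enn2ereal_ennreal)
  qed
  have "ereal_expectation (random_permutation n) X =
      ereal (perm_mean n (\<lambda>\<pi>. max 0 (h \<pi>))) - ereal (perm_mean n (\<lambda>\<pi>. max 0 (- h \<pi>)))"
    unfolding ereal_expectation_def by (subst (1 2) int) (use assms in auto)
  also have "\<dots> = ereal (perm_mean n (\<lambda>\<pi>. max 0 (h \<pi>) - max 0 (- h \<pi>)))"
    by (simp add: perm_mean_diff)
  also have "(\<lambda>\<pi>. max 0 (h \<pi>) - max 0 (- h \<pi>)) = h"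
    by (auto simp: max_def)
  finally show ?thesis .
qed

text \<open>
  This is the case of a reference point outside the domain of \<open>\<psi>\<close>, where the bound holds trivially.
\<close>

lemma ereal_expectation_random_permutation_MInf:
  assumes "\<And>\<pi>. \<pi> permutes {1..n} \<Longrightarrow> X \<pi> = -\<infinity>"
  shows "ereal_expectation (random_permutation n) X = -\<infinity>"
proof -
  let ?S = "{\<pi>. \<pi> permutes {1..n}}"
  have S: "finite ?S" "?S \<noteq> {}"
    by (auto simp: finite_permutations intro: permutes_id)
  have AE: "AE w in measure_pmf (random_permutation n). X w = -\<infinity>"
    using assms S by (auto simp: AE_measure_pmf_iff random_permutation_def)
  have "(\<integral>\<^sup>+ w. e2ennreal (X w) \<partial>measure_pmf (random_permutation n))
      = (\<integral>\<^sup>+ w. 0 \<partial>measure_pmf (random_permutation n))"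
    using AE by (intro nn_integral_cong_AE) (auto simp: e2ennreal_neg elim: eventually_mono)
  moreover have "(\<integral>\<^sup>+ w. e2ennreal (- X w) \<partial>measure_pmf (random_permutation n))
      = (\<integral>\<^sup>+ w. top \<partial>measure_pmf (random_permutation n))"
    using AE by (intro nn_integral_cong_AE) (auto simp: e2ennreal_infty elim: eventually_mono)
  ultimately show ?thesis
    by (simp add: ereal_expectation_def zero_ennreal.rep_eq)
qed

section \<open>Positions within an epoch\<close>

lemma epoch_pos_eq:
  assumes "n \<ge> 1" "t \<ge> 1"
  shows "epoch_pos n t = (t - 1) mod n + 1"
proof -
  define q where "q = (t - 1) div n"
  have t: "t = q * n + (t - 1) mod n + 1"
    using assms div_mult_mod_eq[of "t - 1" n] unfolding q_def by linarith
  have r: "(t - 1) mod n < n" using assms by simp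
  have "\<lceil>real t / real n\<rceil> = int q + 1"
  proof (rule ceiling_unique)
    have "real (q * n) < real t" using t by linarith
    then show "real_of_int (int q + 1) - 1 < real t / real n"
      using assms by (simp add: field_simps)
    have "real t \<le> real (q * n + n)" using t r by linarith
    then show "real t / real n \<le> real_of_int (int q + 1)"
      using assms by (simp add: field_simps)
  qed
  then have "epoch_pos n t = nat (int t - int q * int n)"
    by (simp add: epoch_pos_def)
  also have "\<dots> = (t - 1) mod n + 1"
    using t by (metis add_diff_cancel_left' add.assoc nat_int of_nat_add of_nat_mult)
  finally show ?thesis .
qed

lemma epoch_pos_in:
  assumes "n \<ge> 1" "t \<ge> 1"
  shows "epoch_pos n t \<in> {1..n}"
  using assms by (simp add: epoch_pos_eq Suc_leI)

text \<open>
  The first \<open>k\<close> steps are covered by \<open>k div n + 1\<close> full epochs.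
\<close>

lemma sum_epoch_pos_le:
  fixes h :: "nat \<Rightarrow> real"
  assumes n: "n \<ge> 1" and h: "\<And>i. i \<in> {1..n} \<Longrightarrow> h i \<ge> 0"
  shows "(\<Sum>s=1..<k. h (epoch_pos n s)) \<le> (real k + real n) / real n * (\<Sum>i=1..n. h i)"
proof -
  have full: "(\<Sum>s<q * n. h (s mod n + 1)) = real q * (\<Sum>i=1..n. h i)" for q
  proof (induction q)
    case (Suc q)
    have "(\<Sum>s<Suc q * n. h (s mod n + 1))
        = (\<Sum>s<q * n. h (s mod n + 1)) + (\<Sum>s<n. h ((s + q * n) mod n + 1))"
      using sum.atLeastLessThan_concat[of 0 "q * n" "n + q * n" "\<lambda>s. h (s mod n + 1)"]
        sum.shift_bounds_nat_ivl[of "\<lambda>s. h (s mod n + 1)" 0 "q * n" n]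
      by (simp add: lessThan_atLeast0)
    also have "(\<Sum>s<n. h ((s + q * n) mod n + 1)) = (\<Sum>s<n. h (s + 1))"
      by (intro sum.cong) auto
    also have "\<dots> = (\<Sum>i=1..n. h i)"
      by (simp add: sum.atLeast1_atMost_eq)
    finally show ?case using Suc by (simp add: algebra_simps)
  qed simp
  have k: "k \<le> (k div n + 1) * n"
    using n dividend_less_div_times[of n k] by simp
  have "(\<Sum>s=1..<k. h (epoch_pos n s)) = (\<Sum>s=1..<k. h ((s - 1) mod n + 1))"
    using n by (intro sum.cong) (auto simp: epoch_pos_eq)
  also have "\<dots> = (\<Sum>s<k - 1. h (s mod n + 1))"
    by (rule sum.reindex_bij_witness[where i = Suc and j = "\<lambda>s. s - 1"]) auto
  also have "\<dots> \<le> (\<Sum>s<(k div n + 1) * n. h (s mod n + 1))"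
    using k n by (intro sum_mono2) (auto intro!: h simp: Suc_leI)
  also have "\<dots> = (real (k div n) + 1) * (\<Sum>i=1..n. h i)"
    using full[of "k div n + 1"] by (simp only: of_nat_add of_nat_1)
  also have "\<dots> \<le> (real k + real n) / real n * (\<Sum>i=1..n. h i)"
    using n of_nat_div_le_of_nat[of k n] by (intro mult_right_mono sum_nonneg h)
       (auto simp: add_divide_distrib)
  finally show ?thesis .
qed

section \<open>A proximal step\<close>

text \<open>
  The optimality condition of the proximal step is that \<open>s = (v - u) / \<eta> - g\<close> is a subgradient of \<open>\<psi>\<close>
  at the minimiser \<open>u\<close>. It is derived directly: comparing \<open>u\<close> with
  \<open>(1 - l) u + l y\<close> gives the subgradient inequality up to an error \<open>l K\<close>, and \<open>l\<close> tends to \<open>0\<close>.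
  Strong convexity then adds the quadratic term.
\<close>

lemma prox_step:
  fixes E :: "'a::real_inner set"
  assumes E: "subspace E" and \<psi>: "proper_closed_convex E \<psi>" and sc: "strongly_convex E \<mu> \<psi>"
    and \<eta>: "\<eta> > 0" and v: "v \<in> effective_domain E \<psi>" and g: "g \<in> E"
    and u: "is_arg_min (\<lambda>y. \<psi> y + ereal (inner g y) + ereal ((norm (y - v))\<^sup>2 / (2 * \<eta>)))
      (\<lambda>y. y \<in> E) u"
  shows "u \<in> effective_domain E \<psi>"
    and "\<And>y. y \<in> effective_domain E \<psi> \<Longrightarrow>
      real_of_ereal (\<psi> u) + inner ((1 / \<eta>) *\<^sub>R (v - u) - g) (y - u) + \<mu> / 2 * (norm (y - u))\<^sup>2
        \<le> real_of_ereal (\<psi> y)"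
proof -
  define p where "p y = real_of_ereal (\<psi> y)" for y
  define s where "s = (1 / \<eta>) *\<^sub>R (v - u) - g"
  have p: "\<psi> y = ereal (p y)" if "y \<in> effective_domain E \<psi>" for y
    using that \<psi> unfolding p_def proper_closed_convex_def effective_domain_def
    by (cases "\<psi> y") auto
  have uE: "u \<in> E" and vE: "v \<in> E"
    using u v by (auto simp: is_arg_min_def effective_domain_def)
  have opt: "\<psi> u + ereal (inner g u) + ereal ((norm (u - v))\<^sup>2 / (2 * \<eta>))
     \<le> \<psi> y + ereal (inner g y) + ereal ((norm (y - v))\<^sup>2 / (2 * \<eta>))" if "y \<in> E" for y
    using u that by (auto simp: is_arg_min_def not_less)
  show uD: "u \<in> effective_domain E \<psi>"
    using opt[OF vE] p[OF v] uE by (cases "\<psi> u") (auto simp: effective_domain_def)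
  have sE: "s \<in> E"
    unfolding s_def using E uE vE g by (intro subspace_diff subspace_scale)
  have sub: "p u + inner s (y - u) \<le> p y" if y: "y \<in> effective_domain E \<psi>" for y
  proof -
    define A where "A = p u + inner s (y - u) - p y"
    define K where "K = (norm (y - u))\<^sup>2 / (2 * \<eta>)"
    have K: "K \<ge> 0" using \<eta> by (simp add: K_def)
    have small: "A \<le> l * K" if l: "0 < l" "l < 1" for l
    proof -
      define w where "w = (1 - l) *\<^sub>R u + l *\<^sub>R y"
      have yE: "y \<in> E" using y by (simp add: effective_domain_def)
      have wE: "w \<in> E" unfolding w_def using E uE yE by (intro subspace_add subspace_scale)
      have "(u, p u) \<in> epigraph_in E \<psi>" "(y, p y) \<in> epigraph_in E \<psi>"
        using uE yE p[OF uD] p[OF y] by (auto simp: epigraph_in_def)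
      moreover have "convex (epigraph_in E \<psi>)" using \<psi> by (simp add: proper_closed_convex_def)
      ultimately have "(1 - l) *\<^sub>R (u, p u) + l *\<^sub>R (y, p y) \<in> epigraph_in E \<psi>"
        using l by (intro convexD) auto
      then have \<psi>w: "\<psi> w \<le> ereal ((1 - l) * p u + l * p y)"
        by (simp add: epigraph_in_def w_def)
      have "ereal (p u + inner g u + (norm (u - v))\<^sup>2 / (2 * \<eta>))
          \<le> \<psi> w + ereal (inner g w) + ereal ((norm (w - v))\<^sup>2 / (2 * \<eta>))"
        using opt[OF wE] p[OF uD] by simp
      also have "\<dots> \<le> ereal ((1 - l) * p u + l * p y) + ereal (inner g w)
          + ereal ((norm (w - v))\<^sup>2 / (2 * \<eta>))"
        by (intro add_right_mono \<psi>w)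
      finally have *: "p u + inner g u + (norm (u - v))\<^sup>2 / (2 * \<eta>)
          \<le> (1 - l) * p u + l * p y + inner g w + (norm (w - v))\<^sup>2 / (2 * \<eta>)"
        by simp
      have w': "w - v = (u - v) + l *\<^sub>R (y - u)" by (simp add: w_def algebra_simps)
      have nw: "(norm (w - v))\<^sup>2 = (norm (u - v))\<^sup>2 + 2 * l * inner (u - v) (y - u)
          + l\<^sup>2 * (norm (y - u))\<^sup>2"
        unfolding w' power2_norm_eq_inner
        by (simp add: inner_add_left inner_add_right inner_commute power2_eq_square)
      have gw: "inner g w = inner g u + l * inner g (y - u)"
        by (simp add: w_def algebra_simps inner_add_right inner_diff_right)
      have "(norm (w - v))\<^sup>2 / (2 * \<eta>) = (norm (u - v))\<^sup>2 / (2 * \<eta>)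
          + l * (inner (u - v) (y - u) / \<eta>) + l * (l * K)"
        unfolding nw K_def using \<eta> by (simp add: field_simps power2_eq_square)
      moreover have "inner s (y - u) = - (inner (u - v) (y - u) / \<eta>) - inner g (y - u)"
        by (simp add: s_def inner_diff_left diff_divide_distrib)
      then have "l * A = l * p u - l * (inner (u - v) (y - u) / \<eta>) - l * inner g (y - u) - l * p y"
        unfolding A_def by (simp add: right_diff_distrib distrib_left)
      moreover have "(1 - l) * p u = p u - l * p u" by (simp add: left_diff_distrib)
      ultimately have "l * A \<le> l * (l * K)"
        using * gw by linarith
      then show ?thesis using l by simp
    qed
    have "A \<le> 0"
    proof (rule ccontr)
      assume "\<not> A \<le> 0"
      then have A: "A > 0" by simp
      \<comment> \<open>The choice \<open>l = A / (2 (A + K))\<close> is below \<open>1\<close> also if \<open>K = 0\<close>.\<close>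
      have "A \<le> A / (2 * (A + K)) * K"
        by (rule small) (use A K in \<open>auto simp: field_simps intro: add_pos_nonneg\<close>)
      also have "\<dots> \<le> A / 2" using A K by (simp add: field_simps)
      finally show False using A by simp
    qed
    then show ?thesis by (simp add: A_def)
  qed
  have "s \<in> subdifferential E \<psi> u"
    unfolding subdifferential_def
  proof (intro CollectI conjI ballI sE)
    fix y assume y: "y \<in> E"
    show "\<psi> u + ereal (inner s (y - u)) \<le> \<psi> y"
    proof (cases "\<psi> y < \<infinity>")
      case True
      then have "y \<in> effective_domain E \<psi>" using y by (simp add: effective_domain_def)
      then show ?thesis using sub[of y] by (simp add: p uD)
    qed simp
  qed
  then show "real_of_ereal (\<psi> u) + inner ((1 / \<eta>) *\<^sub>R (v - u) - g) (y - u)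
      + \<mu> / 2 * (norm (y - u))\<^sup>2 \<le> real_of_ereal (\<psi> y)"
    if y: "y \<in> effective_domain E \<psi>" for y
  proof -
    assume s: "s \<in> subdifferential E \<psi> u"
    have "y \<in> E" using y by (simp add: effective_domain_def)
    then have "\<psi> y - \<psi> u - ereal (inner s (y - u)) \<ge> ereal (\<mu> / 2 * (norm (y - u))\<^sup>2)"
      using sc uD s unfolding strongly_convex_def by blast
    then show ?thesis using p[OF y] p[OF uD] unfolding p_def[symmetric] s_def[symmetric] by simp
  qed
qed

text \<open>
  Adding the two optimality conditions cancels \<open>p\<close> and leaves strong monotonicity,
  \<open>(1 + \<eta> \<mu>) \<parallel>u' - u\<parallel>\<^sup>2 \<le> \<langle>(v' - \<eta> g') - (v - \<eta> g), u' - u\<rangle>\<close>, followed by Cauchy--Schwarz.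
\<close>

lemma prox_contraction:
  fixes u u' v v' :: "'a::real_inner"
  assumes \<eta>: "\<eta> > 0" and \<mu>: "\<mu> > 0"
    and 1: "p u + inner ((1 / \<eta>) *\<^sub>R (v - u) - g) (u' - u) + \<mu> / 2 * (norm (u' - u))\<^sup>2 \<le> p u'"
    and 2: "p u' + inner ((1 / \<eta>) *\<^sub>R (v' - u') - g') (u - u') + \<mu> / 2 * (norm (u - u'))\<^sup>2 \<le> p u"
  shows "(1 + \<eta> * \<mu>) * norm (u' - u) \<le> norm ((v' - v) - \<eta> *\<^sub>R (g' - g))"
proof -
  define d where "d = u' - u"
  define e where "e = (v' - v) - \<eta> *\<^sub>R (g' - g)"
  have s: "\<mu> * inner d d \<le> inner (((1 / \<eta>) *\<^sub>R (v' - u') - g') - ((1 / \<eta>) *\<^sub>R (v - u) - g)) d"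
    using 1 2 unfolding d_def norm_minus_commute[of u u'] power2_norm_eq_inner
    by (simp add: inner_diff_left inner_diff_right algebra_simps)
  have eq: "\<eta> *\<^sub>R (((1 / \<eta>) *\<^sub>R (v' - u') - g') - ((1 / \<eta>) *\<^sub>R (v - u) - g)) = e - d"
    using \<eta> by (simp add: d_def e_def algebra_simps)
  have "\<eta> * (\<mu> * inner d d)
      \<le> inner (\<eta> *\<^sub>R (((1 / \<eta>) *\<^sub>R (v' - u') - g') - ((1 / \<eta>) *\<^sub>R (v - u) - g))) d"
    using s \<eta> by simp
  then have "(1 + \<eta> * \<mu>) * (norm d)\<^sup>2 \<le> inner e d"
    unfolding eq by (simp add: inner_diff_left power2_norm_eq_inner algebra_simps)
  also have "\<dots> \<le> norm e * norm d" by (rule norm_cauchy_schwarz)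
  finally have "((1 + \<eta> * \<mu>) * norm d) * norm d \<le> norm e * norm d"
    by (simp add: power2_eq_square mult_ac)
  then have "(1 + \<eta> * \<mu>) * norm d \<le> norm e"
    by (cases "norm d = 0") (auto simp: mult_le_cancel_right)
  then show ?thesis by (simp add: d_def e_def)
qed

text \<open>
  Here \<open>h\<close> is the sampled function and \<open>f\<close> the mean. The displacement \<open>\<delta> = \<parallel>u - v\<parallel>\<close>
  costs at most \<open>(M + L) \<delta>\<close>, and the term \<open>\<delta>\<^sup>2 / (2 \<eta>)\<close> of the proximal step absorbs this up to
  \<open>\<eta> (M + L)\<^sup>2 / 2\<close>.
\<close>

lemma prox_descent:
  fixes u v y :: "'a::real_inner"
  assumes \<eta>: "\<eta> > 0"
    and opt: "p u + inner ((1 / \<eta>) *\<^sub>R (v - u) - g) (y - u) + \<mu> / 2 * (norm (y - u))\<^sup>2 \<le> p y"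
    and sub: "h v + inner g (y - v) \<le> h y"
    and g: "norm g \<le> L" and lip: "f u - f v \<le> M * norm (u - v)"
  shows "(f u + p u) - (f y + p y) \<le> (f v - h v) - (f y - h y)
    + ((norm (y - v))\<^sup>2 / (2 * \<eta>) - (1 / \<eta> + \<mu>) / 2 * (norm (y - u))\<^sup>2) + \<eta> / 2 * (M + L)\<^sup>2"
proof -
  define \<delta> where "\<delta> = norm (u - v)"
  have e1: "inner (v - u) (y - u) = (\<delta>\<^sup>2 + (norm (y - u))\<^sup>2 - (norm (y - v))\<^sup>2) / 2"
    unfolding \<delta>_def power2_norm_eq_inner
    by (simp add: inner_diff_left inner_diff_right inner_commute)
  have e2: "inner g (y - u) = inner g (y - v) + inner g (v - u)"
    by (simp add: inner_diff_right)
  have "inner g (v - u) \<le> norm g * norm (v - u)" by (rule norm_cauchy_schwarz)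
  also have "\<dots> \<le> L * \<delta>" unfolding \<delta>_def norm_minus_commute[of v u]
    by (intro mult_right_mono g) simp
  finally have e3: "inner g (v - u) \<le> L * \<delta>" .
  have "0 \<le> (\<delta> - \<eta> * (M + L))\<^sup>2 / (2 * \<eta>)" using \<eta> by simp
  also have "\<dots> = \<delta>\<^sup>2 / (2 * \<eta>) - (M + L) * \<delta> + \<eta> / 2 * (M + L)\<^sup>2"
    using \<eta> by (simp add: field_simps power2_eq_square)
  finally have e4: "(M + L) * \<delta> \<le> \<delta>\<^sup>2 / (2 * \<eta>) + \<eta> / 2 * (M + L)\<^sup>2" by simp
  have e5: "inner ((1 / \<eta>) *\<^sub>R (v - u) - g) (y - u)
      = \<delta>\<^sup>2 / (2 * \<eta>) + 1 / \<eta> / 2 * (norm (y - u))\<^sup>2 - (norm (y - v))\<^sup>2 / (2 * \<eta>) - inner g (y - u)"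
    unfolding inner_diff_left[of _ g] inner_scaleR_left e1 using \<eta> by (simp add: field_simps)
  show ?thesis
    using opt sub lip e2 e3 e4 unfolding \<delta>_def[symmetric] e5 distrib_right add_divide_distrib
    by linarith
qed

section \<open>From suffix averages to the last element\<close>

text \<open>
  Let \<open>a\<^sub>k\<close> be the weighted average of \<open>\<Delta>\<^bsub>t+1\<^esub> - b\<^sub>t\<close> over \<open>k \<le> t \<le> T\<close>. The suffix estimate at \<open>k + 1\<close> says
  \<open>a\<^bsub>k+1\<^esub> \<le> \<Delta>\<^bsub>k+1\<^esub> + d\<^bsub>k+1\<^esub>\<close>. Since \<open>a\<^sub>k\<close> is a convex combination of \<open>\<Delta>\<^bsub>k+1\<^esub> - b\<^sub>k\<close>, with weight
  \<open>w\<^sub>k / W\<^sub>k\<close>, and of \<open>a\<^bsub>k+1\<^esub>\<close>, removing the first element of the suffix increases the average by at most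
  \<open>(b\<^sub>k + d\<^sub>k) w\<^sub>k / W\<^sub>k\<close>. Nondecreasing weights make this ratio at most \<open>1 / (T + 1 - k)\<close>. The average
  \<open>a\<^sub>T\<close> over the shortest suffix is the last element up to \<open>b\<^sub>T\<close>.
\<close>

lemma last_le_of_suffix_averages:
  fixes w \<Delta> b d :: "nat \<Rightarrow> real"
  assumes T: "T \<ge> 1" and w: "\<And>t. t \<ge> 1 \<Longrightarrow> w t > 0" and w_mono: "\<And>s t. 1 \<le> s \<Longrightarrow> s \<le> t \<Longrightarrow> w s \<le> w t"
    and b: "\<And>t. t \<ge> 1 \<Longrightarrow> b t \<ge> 0" and d: "\<And>t. t \<ge> 1 \<Longrightarrow> d t \<ge> 0"
    and d_antimono: "\<And>t. t \<ge> 1 \<Longrightarrow> d (Suc t) \<le> d t"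
    and first: "(\<Sum>t=1..T. w t * \<Delta> (Suc t)) \<le> P + (\<Sum>t=1..T. w t * b t)"
    and suffix: "\<And>k. 2 \<le> k \<Longrightarrow> k \<le> T \<Longrightarrow>
      (\<Sum>t=k..T. w t * (\<Delta> (Suc t) - \<Delta> k)) \<le> (\<Sum>t=k..T. w t * (b t + d k))"
  shows "\<Delta> (Suc T) \<le> P / (\<Sum>t=1..T. w t) + (\<Sum>t=1..T. (b t + d t) / real (T + 1 - t))"
proof -
  define e where "e t = \<Delta> (Suc t) - b t" for t
  define W where "W k = (\<Sum>t=k..T. w t)" for k
  define a where "a k = (\<Sum>t=k..T. w t * e t) / W k" for k
  have W: "W k > 0" if "1 \<le> k" "k \<le> T" for k
    unfolding W_def using that by (intro sum_pos) (auto intro: w)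
  have Wa: "W k * a k = (\<Sum>t=k..T. w t * e t)" if "1 \<le> k" "k \<le> T" for k
    using W[OF that] by (simp add: a_def)
  have ratio: "w k / W k \<le> 1 / real (T + 1 - k)" if k: "1 \<le> k" "k \<le> T" for k
  proof -
    have "real (T + 1 - k) * w k = (\<Sum>t=k..T. w k)" by simp
    also have "\<dots> \<le> W k" unfolding W_def using k by (intro sum_mono w_mono) auto
    finally show ?thesis using W[OF k] k by (simp add: field_simps)
  qed
  have step: "a k \<le> P / W 1 + (\<Sum>t=1..<k. (b t + d t) / real (T + 1 - t))" if "1 \<le> k" "k \<le> T" for k
    using that
  proof (induction k rule: dec_induct)
    case base
    have "(\<Sum>t=1..T. w t * e t) \<le> P"
      using first by (simp add: e_def right_diff_distrib sum_subtractf)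
    then show ?case using W[of 1] T by (simp add: a_def divide_right_mono)
  next
    case (step k)
    define q where "q = b k + d k"
    have k: "1 \<le> k" "k \<le> T" "1 \<le> Suc k" "Suc k \<le> T" using step by auto
    have q: "q \<ge> 0" using b d k by (simp add: q_def)
    have "(\<Sum>t=Suc k..T. w t * (e t - (\<Delta> (Suc k) + d (Suc k)))) \<le> 0"
      using suffix[of "Suc k"] k by (simp add: e_def algebra_simps sum.distrib sum_subtractf)
    then have "W (Suc k) * a (Suc k) \<le> W (Suc k) * (\<Delta> (Suc k) + d (Suc k))"
      unfolding Wa[OF k(3,4)]
      by (simp add: W_def right_diff_distrib sum_subtractf sum_distrib_right)
    then have "a (Suc k) \<le> \<Delta> (Suc k) + d (Suc k)"
      using W[OF k(3,4)] by (simp add: mult_le_cancel_left)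
    also have "\<dots> \<le> e k + q" using d_antimono[OF k(1)] by (simp add: e_def q_def)
    finally have le: "a (Suc k) \<le> e k + q" .
    have "W k = w k + W (Suc k)"
      unfolding W_def using k by (simp add: sum.atLeast_Suc_atMost)
    moreover have "W k * a k = w k * e k + W (Suc k) * a (Suc k)"
      unfolding Wa[OF k(1,2)] Wa[OF k(3,4)] using k by (simp add: sum.atLeast_Suc_atMost)
    moreover have "w k * a (Suc k) \<le> w k * (e k + q)"
      using le w[OF k(1)] by simp
    ultimately have "W k * a (Suc k) \<le> W k * a k + w k * q"
      by (simp add: algebra_simps)
    then have "a (Suc k) \<le> a k + w k / W k * q"
      using W[OF k(1,2)] by (simp add: field_simps)
    also have "w k / W k * q \<le> 1 / real (T + 1 - k) * q"
      using q ratio[OF k(1,2)] by (intro mult_right_mono)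
    also have "1 / real (T + 1 - k) * q = (b k + d k) / real (T + 1 - k)"
      by (simp add: q_def)
    finally show ?case using step by simp
  qed
  have "a T = \<Delta> (Suc T) - b T" using w[of T] T by (simp add: a_def W_def e_def)
  moreover have "(\<Sum>t=1..T. (b t + d t) / real (T + 1 - t))
      = (\<Sum>t=1..<T. (b t + d t) / real (T + 1 - t)) + (b T + d T)"
    using T by (cases T) (simp_all add: atLeastLessThanSuc_atLeastAtMost)
  ultimately show ?thesis
    using step[OF T order_refl] d[OF T] unfolding W_def by linarith
qed

lemma harm_le_ln:
  assumes "T \<ge> 1"
  shows "(\<Sum>t=1..T. 1 / real t) \<le> 1 + ln (real T)"
  using euler_mascheroni_sequence_decreasing[of 1 T] assms
  by (simp add: harm_def inverse_eq_divide)

lemma sum_reverse_weights: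
  "(\<Sum>t=1..T. 1 / real (T + 1 - t)) = (\<Sum>t=1..T. 1 / real t)"
  by (rule sum.reindex_bij_witness[where i = "\<lambda>t. T + 1 - t" and j = "\<lambda>t. T + 1 - t"]) auto

lemma sum_inverse_weights:
  assumes "T \<ge> 1"
  shows "(\<Sum>t=1..T. 1 / real t / real (T + 1 - t)) \<le> 2 * (1 + ln (real T)) / real T"
proof -
  have "1 / real t / real (T + 1 - t) \<le> 1 / real T * (1 / real t + 1 / real (T + 1 - t))"
    if "t \<in> {1..T}" for t
  proof -
    have "1 / real t / real (T + 1 - t) = 1 / real (T + 1) * (1 / real t + 1 / real (T + 1 - t))"
      using that by (simp add: field_simps of_nat_diff)
    also have "\<dots> \<le> 1 / real T * (1 / real t + 1 / real (T + 1 - t))"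
      using that by (intro mult_right_mono) (auto simp: frac_le)
    finally show ?thesis .
  qed
  then have "(\<Sum>t=1..T. 1 / real t / real (T + 1 - t))
      \<le> (\<Sum>t=1..T. 1 / real T * (1 / real t + 1 / real (T + 1 - t)))"
    by (rule sum_mono)
  also have "\<dots> = 1 / real T * (2 * (\<Sum>t=1..T. 1 / real t))"
    unfolding sum_distrib_left[symmetric] sum.distrib sum_reverse_weights by simp
  also have "\<dots> \<le> 1 / real T * (2 * (1 + ln (real T)))"
    using harm_le_ln[OF assms] by (intro mult_left_mono) auto
  finally show ?thesis by simp
qed

text \<open>
  Since \<open>\<surd>T \<le> \<surd>t + \<surd>(T + 1 - t)\<close>, each summand times \<open>\<surd>T\<close> is at most
  \<open>1 / (\<surd>t \<surd>(T + 1 - t)) + 1 / (T + 1 - t)\<close>, and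
  the first term of this is at most the mean of \<open>1 / t\<close> and \<open>1 / (T + 1 - t)\<close>.
\<close>

lemma sum_inverse_sqrt_weights:
  assumes "T \<ge> 1"
  shows "(\<Sum>t=1..T. 1 / sqrt (real t) / real (T + 1 - t)) \<le> 2 * (1 + ln (real T)) / sqrt (real T)"
proof -
  have "1 / sqrt (real t) / real (T + 1 - t)
      \<le> 1 / sqrt (real T) * (1/2 * (1 / real t + 1 / real (T + 1 - t)) + 1 / real (T + 1 - t))"
    if t: "t \<in> {1..T}" for t
  proof -
    define p where "p = sqrt (real t)"
    define q where "q = sqrt (real (T + 1 - t))"
    have pq: "p > 0" "q > 0" "p\<^sup>2 = real t" "q\<^sup>2 = real (T + 1 - t)"
      using t by (auto simp: p_def q_def)
    have "sqrt (real T) \<le> sqrt (real t + real (T + 1 - t))"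
      using t by (intro real_sqrt_le_mono) (auto simp: of_nat_diff)
    also have "\<dots> \<le> p + q"
      unfolding p_def q_def by (rule sqrt_add_le_add_sqrt) auto
    finally have "sqrt (real T) * (1 / p / q\<^sup>2) \<le> (p + q) * (1 / p / q\<^sup>2)"
      using pq by (intro mult_right_mono) auto
    also have "\<dots> = 1 / p * (1 / q) + 1 / q\<^sup>2"
      using pq(1,2) by (simp add: field_simps power2_eq_square)
    also have "1 / p * (1 / q) \<le> 1/2 * (1 / p\<^sup>2 + 1 / q\<^sup>2)"
      using sum_squares_bound[of "1 / p" "1 / q"] by (simp add: power_divide)
    finally have "sqrt (real T) * (1 / p / real (T + 1 - t))
        \<le> 1/2 * (1 / real t + 1 / real (T + 1 - t)) + 1 / real (T + 1 - t)"
      unfolding pq by simp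
    moreover have "c \<le> 1 / s * r" if "s * c \<le> r" "s > 0" for c r s :: real
      using that by (simp add: field_simps)
    ultimately show ?thesis using t unfolding p_def by simp
  qed
  then have "(\<Sum>t=1..T. 1 / sqrt (real t) / real (T + 1 - t))
      \<le> (\<Sum>t=1..T. 1 / sqrt (real T) *
          (1/2 * (1 / real t + 1 / real (T + 1 - t)) + 1 / real (T + 1 - t)))"
    by (rule sum_mono)
  also have "\<dots> = 1 / sqrt (real T) * (2 * (\<Sum>t=1..T. 1 / real t))"
    unfolding sum_distrib_left[symmetric] sum.distrib sum_reverse_weights by simp
  also have "\<dots> \<le> 1 / sqrt (real T) * (2 * (1 + ln (real T)))"
    using harm_le_ln[OF assms] by (intro mult_left_mono) auto
  finally show ?thesis by simp
qed

section \<open>Averages of the Lipschitz constants\<close>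

lemma rms_G_power2: "n \<ge> 1 \<Longrightarrow> (rms_G n G)\<^sup>2 = (\<Sum>i=1..n. (G i)\<^sup>2) / real n"
  by (simp add: rms_G_def sum_nonneg)

lemma rms_G_nonneg: "rms_G n G \<ge> 0"
  by (simp add: rms_G_def sum_nonneg)

lemma mean_G_le_rms_G:
  assumes "n \<ge> 1"
  shows "mean_G n G \<le> rms_G n G"
  unfolding rms_G_def
proof (rule real_le_rsqrt)
  have "(\<Sum>i=1..n. G i)\<^sup>2 \<le> (\<Sum>i=1..n. (G i)\<^sup>2) * real n"
    using sum_squared_le_sum_of_squares[of G "{1..n}"] by simp
  then show "(mean_G n G)\<^sup>2 \<le> 1 / real n * (\<Sum>i=1..n. (G i)\<^sup>2)"
    using assms by (simp add: mean_G_def power_divide power2_eq_square field_simps)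
qed

lemma rms_G_le_sqrt_mean_G:
  assumes "n \<ge> 1" "\<And>i. i \<in> {1..n} \<Longrightarrow> G i \<ge> 0"
  shows "rms_G n G \<le> sqrt (real n) * mean_G n G"
proof -
  have "rms_G n G = L2_set G {1..n} / sqrt (real n)"
    by (simp add: rms_G_def L2_set_def real_sqrt_divide)
  also have "\<dots> \<le> (\<Sum>i=1..n. G i) / sqrt (real n)"
    using assms by (intro divide_right_mono L2_set_le_sum) auto
  also have "\<dots> = sqrt (real n) * mean_G n G"
    using assms by (simp add: mean_G_def field_simps)
  finally show ?thesis .
qed

text \<open>
  The induction step for the distance of two runs: \<open>P\<close> collects the steps that add in squares and
  \<open>Q\<close> those that add linearly, and a further step \<open>q\<close> of the first kind keeps this form.
\<close>

lemma sqrt_add_square_le: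
  fixes P Q q u :: real
  assumes "P \<ge> 0" "Q \<ge> 0" "0 \<le> u" "u \<le> sqrt P + Q"
  shows "sqrt (u\<^sup>2 + q\<^sup>2) \<le> sqrt (P + q\<^sup>2) + Q"
proof (rule real_le_lsqrt)
  have "u\<^sup>2 \<le> (sqrt P + Q)\<^sup>2" using assms by (intro power_mono)
  moreover have "sqrt P * Q \<le> sqrt (P + q\<^sup>2) * Q" using assms by (intro mult_right_mono) auto
  ultimately show "u\<^sup>2 + q\<^sup>2 \<le> (sqrt (P + q\<^sup>2) + Q)\<^sup>2"
    using assms by (simp add: power2_sum)
qed (use assms in auto)

section \<open>Iterates under single shuffling\<close>

text \<open>
  The run is given for every permutation at once, because the analysis compares the runs of
  different permutations.
\<close>

locale shuffled_prox =
  fixes E :: "'a::real_inner set" and n T m :: nat and \<mu> :: real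
    and f :: "nat \<Rightarrow> 'a \<Rightarrow> real" and gf :: "nat \<Rightarrow> 'a \<Rightarrow> 'a" and \<psi> :: "'a \<Rightarrow> ereal"
    and G :: "nat \<Rightarrow> real" and x1 :: 'a and x :: "(nat \<Rightarrow> nat) \<Rightarrow> nat \<Rightarrow> 'a"
  assumes E: "subspace E" and n: "n \<ge> 1" and T: "T \<ge> 1" and m: "m \<ge> 1" and \<mu>: "\<mu> > 0"
    and \<psi>: "proper_closed_convex E \<psi>" and sc: "strongly_convex E \<mu> \<psi>"
    and gf: "\<And>i y. i \<in> {1..n} \<Longrightarrow> y \<in> E \<Longrightarrow> gf i y \<in> subdifferential E (\<lambda>v. ereal (f i v)) y"
    and G_pos: "\<And>i. i \<in> {1..n} \<Longrightarrow> G i > 0"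
    and lip_grad: "\<And>i. i \<in> {1..n} \<Longrightarrow>
      lipschitz_with_gradient (G i) (effective_domain E \<psi>) (f i) (gf i)"
    and x1: "x1 \<in> effective_domain E \<psi>"
    and iterates: "\<And>\<pi>. \<pi> permutes {1..n} \<Longrightarrow>
      prox_gradient_iterates E \<psi> gf (\<lambda>t. real m / (\<mu> * real t)) (single_shuffle n \<pi>) T x1 (x \<pi>)"
begin

abbreviation D :: "'a set" where "D \<equiv> effective_domain E \<psi>"

abbreviation \<eta> :: "nat \<Rightarrow> real" where "\<eta> t \<equiv> real m / (\<mu> * real t)"

abbreviation idx :: "(nat \<Rightarrow> nat) \<Rightarrow> nat \<Rightarrow> nat" where "idx \<equiv> single_shuffle n"

definition p :: "'a \<Rightarrow> real" where "p y = real_of_ereal (\<psi> y)"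

definition f_mean :: "'a \<Rightarrow> real" where "f_mean y = 1 / real n * (\<Sum>i=1..n. f i y)"

definition F :: "'a \<Rightarrow> real" where "F y = f_mean y + p y"

abbreviation G1 :: real where "G1 \<equiv> mean_G n G"

abbreviation G2 :: real where "G2 \<equiv> rms_G n G"

lemma D_subset: "y \<in> D \<Longrightarrow> y \<in> E"
  by (simp add: effective_domain_def)

lemma psi_eq: "y \<in> D \<Longrightarrow> \<psi> y = ereal (p y)"
  using \<psi> unfolding p_def proper_closed_convex_def effective_domain_def
  by (cases "\<psi> y") auto

lemma objective_eq: "y \<in> D \<Longrightarrow> objective n f \<psi> y = ereal (F y)"
  by (simp add: objective_def psi_eq F_def f_mean_def)

lemma stepsize_pos: "t \<ge> 1 \<Longrightarrow> \<eta> t > 0"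
  using m \<mu> by simp

lemma G1_nonneg: "G1 \<ge> 0"
  unfolding mean_G_def using G_pos by (intro mult_nonneg_nonneg sum_nonneg) (auto intro: less_imp_le)

lemma idx_in: "\<pi> permutes {1..n} \<Longrightarrow> t \<ge> 1 \<Longrightarrow> idx \<pi> t \<in> {1..n}"
  using epoch_pos_in[OF n] permutes_in_image by (fastforce simp: single_shuffle_def)

lemma grad_in: "i \<in> {1..n} \<Longrightarrow> y \<in> E \<Longrightarrow> gf i y \<in> E"
  using gf by (auto simp: subdifferential_def)

lemma grad_ineq: "i \<in> {1..n} \<Longrightarrow> v \<in> E \<Longrightarrow> y \<in> E \<Longrightarrow> f i v + inner (gf i v) (y - v) \<le> f i y"
  using gf[of i v] by (auto simp: subdifferential_def)

lemma grad_bound: "i \<in> {1..n} \<Longrightarrow> y \<in> D \<Longrightarrow> norm (gf i y) \<le> G i"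
  using lip_grad by (auto simp: lipschitz_with_gradient_def)

lemma f_lipschitz: "i \<in> {1..n} \<Longrightarrow> (G i)-lipschitz_on D (f i)"
  using lip_grad by (auto simp: lipschitz_with_gradient_def)

lemma f_mean_lipschitz:
  assumes "u \<in> D" "v \<in> D"
  shows "f_mean u - f_mean v \<le> G1 * norm (u - v)"
proof -
  have "(\<Sum>i=1..n. f i u - f i v) \<le> (\<Sum>i=1..n. G i * norm (u - v))"
  proof (rule sum_mono)
    fix i assume "i \<in> {1..n}"
    from lipschitz_onD[OF f_lipschitz[OF this] assms] show "f i u - f i v \<le> G i * norm (u - v)"
      by (simp add: dist_norm)
  qed
  then have "1 / real n * (\<Sum>i=1..n. f i u - f i v) \<le> 1 / real n * (\<Sum>i=1..n. G i * norm (u - v))"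
    by (rule mult_left_mono) simp
  then show ?thesis
    unfolding sum_subtractf sum_distrib_right[symmetric] f_mean_def mean_G_def
    by (simp only: right_diff_distrib mult.assoc)
qed

lemma iterate_prox:
  assumes "\<pi> permutes {1..n}" "1 \<le> t" "t \<le> T"
  shows "is_arg_min (\<lambda>y. \<psi> y + ereal (inner (gf (idx \<pi> t) (x \<pi> t)) y)
      + ereal ((norm (y - x \<pi> t))\<^sup>2 / (2 * \<eta> t))) (\<lambda>y. y \<in> E) (x \<pi> (Suc t))"
  using iterates[OF assms(1)] assms(2,3) unfolding prox_gradient_iterates_def by auto

lemma iterate_in:
  assumes \<pi>: "\<pi> permutes {1..n}" and "1 \<le> t" "t \<le> Suc T"
  shows "x \<pi> t \<in> D"
  using assms(2,3)
proof (induction t rule: dec_induct)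
  case base
  show ?case using iterates[OF \<pi>] x1 by (simp add: prox_gradient_iterates_def)
next
  case (step t)
  then have "x \<pi> t \<in> D" by simp
  with step show ?case
    by (intro prox_step(1)[OF E \<psi> sc stepsize_pos _ _ iterate_prox[OF \<pi>]] grad_in idx_in \<pi>)
      (auto simp: D_subset)
qed

lemma iterate_opt:
  assumes \<pi>: "\<pi> permutes {1..n}" and t: "1 \<le> t" "t \<le> T" and y: "y \<in> D"
  shows "p (x \<pi> (Suc t))
      + inner ((1 / \<eta> t) *\<^sub>R (x \<pi> t - x \<pi> (Suc t)) - gf (idx \<pi> t) (x \<pi> t)) (y - x \<pi> (Suc t))
      + \<mu> / 2 * (norm (y - x \<pi> (Suc t)))\<^sup>2 \<le> p y"
  unfolding p_def
  using iterate_in[OF \<pi>, of t] t idx_in[OF \<pi> t(1)]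
  by (intro prox_step(2)[OF E \<psi> sc stepsize_pos _ _ iterate_prox[OF \<pi>] y] grad_in)
    (auto simp: D_subset)

section \<open>Stability under a change of the permutation\<close>

text \<open>
  Monotonicity of the subdifferential gives the cross term the favourable sign. For nonsmooth \<open>f\<^sub>i\<close> the
  remaining term cannot be avoided, but it enters in squares only.
\<close>

lemma gradient_step_nonexpansive:
  assumes i: "i \<in> {1..n}" and v: "v \<in> D" "v' \<in> D" and h: "h \<ge> 0"
  shows "norm ((v' - v) - h *\<^sub>R (gf i v' - gf i v)) \<le> sqrt ((norm (v' - v))\<^sup>2 + (2 * h * G i)\<^sup>2)"
proof (rule real_le_rsqrt)
  let ?g = "gf i v' - gf i v"
  have "norm ?g \<le> 2 * G i"
    using norm_triangle_ineq4[of "gf i v'" "gf i v"] grad_bound[OF i v(1)] grad_bound[OF i v(2)]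
    by linarith
  then have "h * norm ?g \<le> 2 * h * G i"
    using mult_left_mono[OF _ h] by fastforce
  then have "(h * norm ?g)\<^sup>2 \<le> (2 * h * G i)\<^sup>2"
    using h by (intro power_mono) auto
  moreover have "inner ?g (v' - v) \<ge> 0"
    using grad_ineq[OF i, of v v'] grad_ineq[OF i, of v' v] v
    by (simp add: D_subset inner_diff_left inner_diff_right)
  then have "h * inner ?g (v' - v) \<ge> 0" using h by simp
  moreover have "(norm ((v' - v) - h *\<^sub>R ?g))\<^sup>2
      = (norm (v' - v))\<^sup>2 - 2 * (h * inner ?g (v' - v)) + (h * norm ?g)\<^sup>2"
  proof -
    have "(norm (a - b))\<^sup>2 = (norm a)\<^sup>2 - 2 * inner b a + (norm b)\<^sup>2" for a b :: 'a
      unfolding power2_norm_eq_inner by (simp add: inner_diff_left inner_diff_right inner_commute)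
    from this[of "v' - v" "h *\<^sub>R ?g"] show ?thesis using h by simp
  qed
  ultimately show "(norm ((v' - v) - h *\<^sub>R ?g))\<^sup>2 \<le> (norm (v' - v))\<^sup>2 + (2 * h * G i)\<^sup>2"
    by linarith
qed

text \<open>
  The scaled distance \<open>t \<parallel>x\<^sub>t(\<rho>) - x\<^sub>t(\<pi>)\<parallel>\<close> is the natural quantity: the contraction factor
  \<open>t / (t + m) \<le> t / (t + 1)\<close> absorbs the passage from \<open>t\<close> to \<open>t + 1\<close>, and the scaled stepsize
  \<open>t \<eta>\<^sub>t = m / \<mu>\<close> is constant.
\<close>

lemma iterate_stability:
  assumes \<pi>: "\<pi> permutes {1..n}" and \<rho>: "\<rho> permutes {1..n}" and k: "1 \<le> k" "k \<le> Suc T"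
  shows "real k * norm (x \<rho> k - x \<pi> k) \<le>
    sqrt (\<Sum>s=1..<k. (2 * (real m / \<mu>) * G (idx \<pi> s))\<^sup>2)
    + (\<Sum>s=1..<k. if idx \<pi> s = idx \<rho> s then 0 else real m / \<mu> * (G (idx \<pi> s) + G (idx \<rho> s)))"
  using k
proof (induction k rule: dec_induct)
  case base
  then show ?case using iterates[OF \<pi>] iterates[OF \<rho>] by (simp add: prox_gradient_iterates_def)
next
  case (step t)
  define c where "c = real m / \<mu>"
  define P where "P k = (\<Sum>s=1..<k. (2 * c * G (idx \<pi> s))\<^sup>2)" for k
  define Q where "Q k = (\<Sum>s=1..<k. if idx \<pi> s = idx \<rho> s then 0 else c * (G (idx \<pi> s) + G (idx \<rho> s)))" for k
  define \<delta> where "\<delta> = norm (x \<rho> t - x \<pi> t)"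
  define g where "g = gf (idx \<pi> t) (x \<pi> t)"
  define g' where "g' = gf (idx \<rho> t) (x \<rho> t)"
  have t: "1 \<le> t" "t \<le> T" using step by auto
  have c: "c > 0" using m \<mu> by (simp add: c_def)
  have i: "idx \<pi> t \<in> {1..n}" "idx \<rho> t \<in> {1..n}" using idx_in \<pi> \<rho> t by auto
  have D: "x \<pi> t \<in> D" "x \<rho> t \<in> D" "x \<pi> (Suc t) \<in> D" "x \<rho> (Suc t) \<in> D"
    using iterate_in \<pi> \<rho> t by auto
  have \<eta>: "real t * \<eta> t = c" using t by (simp add: c_def)
  have P0: "P t \<ge> 0" by (simp add: P_def sum_nonneg)
  have Q0: "Q t \<ge> 0" unfolding Q_def
  proof (rule sum_nonneg)
    fix s assume "s \<in> {1..<t}"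
    then have "G (idx \<pi> s) > 0" "G (idx \<rho> s) > 0" by (auto intro!: G_pos idx_in \<pi> \<rho>)
    then show "0 \<le> (if idx \<pi> s = idx \<rho> s then 0 else c * (G (idx \<pi> s) + G (idx \<rho> s)))"
      using c by simp
  qed
  have IH: "real t * \<delta> \<le> sqrt (P t) + Q t"
    using step unfolding P_def Q_def c_def \<delta>_def by simp
  have "(1 + \<eta> t * \<mu>) * norm (x \<rho> (Suc t) - x \<pi> (Suc t)) \<le> norm ((x \<rho> t - x \<pi> t) - \<eta> t *\<^sub>R (g' - g))"
    unfolding g_def g'_def
    by (rule prox_contraction[OF stepsize_pos[OF t(1)] \<mu>, where p = p])
      (rule iterate_opt[OF \<pi> t D(4)] iterate_opt[OF \<rho> t D(3)])+
  then have "real t * ((1 + \<eta> t * \<mu>) * norm (x \<rho> (Suc t) - x \<pi> (Suc t)))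
      \<le> real t * norm ((x \<rho> t - x \<pi> t) - \<eta> t *\<^sub>R (g' - g))"
    by (rule mult_left_mono) simp
  moreover have "real t * (1 + \<eta> t * \<mu>) = real t + real m"
    using t \<mu> by (simp add: field_simps)
  moreover have "real (Suc t) * norm (x \<rho> (Suc t) - x \<pi> (Suc t))
      \<le> (real t + real m) * norm (x \<rho> (Suc t) - x \<pi> (Suc t))"
    using m by (intro mult_right_mono) auto
  ultimately have main: "real (Suc t) * norm (x \<rho> (Suc t) - x \<pi> (Suc t))
      \<le> real t * norm ((x \<rho> t - x \<pi> t) - \<eta> t *\<^sub>R (g' - g))"
    by (simp add: mult.assoc[symmetric])
  also have "\<dots> \<le> sqrt (P (Suc t)) + Q (Suc t)"
  proof (cases "idx \<pi> t = idx \<rho> t")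
    case True
    have "real t * norm ((x \<rho> t - x \<pi> t) - \<eta> t *\<^sub>R (g' - g))
        \<le> real t * sqrt (\<delta>\<^sup>2 + (2 * \<eta> t * G (idx \<pi> t))\<^sup>2)"
      unfolding g_def g'_def \<delta>_def True[symmetric]
      using stepsize_pos[OF t(1)] by (intro mult_left_mono gradient_step_nonexpansive i D) auto
    also have "\<dots> = sqrt ((real t)\<^sup>2 * (\<delta>\<^sup>2 + (2 * \<eta> t * G (idx \<pi> t))\<^sup>2))"
      by (simp add: real_sqrt_mult)
    also have "(real t)\<^sup>2 * (\<delta>\<^sup>2 + (2 * \<eta> t * G (idx \<pi> t))\<^sup>2)
        = (real t * \<delta>)\<^sup>2 + (2 * (real t * \<eta> t) * G (idx \<pi> t))\<^sup>2"
      by (simp only: power_mult_distrib distrib_left mult_ac)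
    also have "sqrt \<dots> \<le> sqrt (P t + (2 * (real t * \<eta> t) * G (idx \<pi> t))\<^sup>2) + Q t"
      by (rule sqrt_add_square_le[OF P0 Q0 _ IH]) (simp add: \<delta>_def)
    also have "\<dots> = sqrt (P (Suc t)) + Q (Suc t)"
      using t True unfolding \<eta> by (simp add: P_def Q_def)
    finally show ?thesis .
  next
    case False
    have "norm (g' - g) \<le> G (idx \<pi> t) + G (idx \<rho> t)"
      using norm_triangle_ineq4[of g' g] grad_bound[OF i(1) D(1)] grad_bound[OF i(2) D(2)]
      unfolding g_def g'_def by linarith
    then have "\<eta> t * norm (g' - g) \<le> \<eta> t * (G (idx \<pi> t) + G (idx \<rho> t))"
      using stepsize_pos[OF t(1)] by (intro mult_left_mono) auto
    then have "norm ((x \<rho> t - x \<pi> t) - \<eta> t *\<^sub>R (g' - g)) \<le> \<delta> + \<eta> t * (G (idx \<pi> t) + G (idx \<rho> t))"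
      using norm_triangle_ineq4[of "x \<rho> t - x \<pi> t" "\<eta> t *\<^sub>R (g' - g)"]
      unfolding \<delta>_def norm_scaleR abs_of_pos[OF stepsize_pos[OF t(1)]] by linarith
    then have "real t * norm ((x \<rho> t - x \<pi> t) - \<eta> t *\<^sub>R (g' - g))
        \<le> real t * (\<delta> + \<eta> t * (G (idx \<pi> t) + G (idx \<rho> t)))"
      by (rule mult_left_mono) simp
    also have "\<dots> = real t * \<delta> + c * (G (idx \<pi> t) + G (idx \<rho> t))"
      unfolding \<eta>[symmetric] by (simp only: distrib_left mult.assoc)
    also have "\<dots> \<le> sqrt (P t) + Q (Suc t)"
      using IH t False by (simp add: Q_def)
    also have "sqrt (P t) \<le> sqrt (P (Suc t))" using t by (simp add: P_def)
    finally show ?thesis by simp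
  qed
  finally show ?case unfolding P_def Q_def c_def .
qed

lemma swap_stability:
  assumes \<pi>: "\<pi> permutes {1..n}" and r: "r \<in> {1..n}" and j: "j \<in> {1..n}"
    and k: "1 \<le> k" "k \<le> Suc T"
  shows "norm (x (\<pi> \<circ> Transposition.transpose r j) k - x \<pi> k)
    \<le> real m / \<mu> * (2 * sqrt (real k + real n) * G2
        + 2 * ((real k + real n) / real n) * (G (\<pi> r) + G (\<pi> j))) / real k"
proof -
  define c where "c = real m / \<mu>"
  define \<rho> where "\<rho> = \<pi> \<circ> Transposition.transpose r j"
  define N where "N = (real k + real n) / real n"
  define Gs where "Gs = G (\<pi> r) + G (\<pi> j)"
  \<comment> \<open>The sum of two conditionals counts a position twice if \<open>r = j\<close>, which is harmless and keeps
    the total equal to \<open>2 c Gs\<close> without a case distinction.\<close>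
  define h where "h i = (if i = r then c * Gs else 0) + (if i = j then c * Gs else 0)" for i
  have \<rho>: "\<rho> permutes {1..n}" unfolding \<rho>_def using \<pi> r j by (rule permutes_swap_comp)
  have c: "c > 0" using m \<mu> by (simp add: c_def)
  have Gs: "Gs > 0" unfolding Gs_def
    using permutes_in_image[OF \<pi>] r j by (intro add_pos_pos G_pos) auto
  have cGs: "c * Gs \<ge> 0" using c Gs by simp
  have "(\<Sum>s=1..<k. (2 * c * G (idx \<pi> s))\<^sup>2) = 4 * c\<^sup>2 * (\<Sum>s=1..<k. (G (\<pi> (epoch_pos n s)))\<^sup>2)"
    unfolding sum_distrib_left single_shuffle_def by (simp add: power_mult_distrib)
  also have "\<dots> \<le> 4 * c\<^sup>2 * ((real k + real n) / real n * (\<Sum>i=1..n. (G (\<pi> i))\<^sup>2))"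
    by (intro mult_left_mono sum_epoch_pos_le n) auto
  also have "(\<Sum>i=1..n. (G (\<pi> i))\<^sup>2) = real n * G2\<^sup>2"
    using n sum_perm[OF \<pi>, of "\<lambda>i. (G i)\<^sup>2"] by (simp only: rms_G_power2) simp
  finally have "sqrt (\<Sum>s=1..<k. (2 * c * G (idx \<pi> s))\<^sup>2) \<le> sqrt ((2 * c)\<^sup>2 * ((real k + real n) * G2\<^sup>2))"
    using n by (intro real_sqrt_le_mono) (simp add: power_mult_distrib)
  also have "\<dots> = c * (2 * sqrt (real k + real n) * G2)"
    using c rms_G_nonneg[of n G] by (simp add: real_sqrt_mult)
  finally have 1: "sqrt (\<Sum>s=1..<k. (2 * c * G (idx \<pi> s))\<^sup>2) \<le> c * (2 * sqrt (real k + real n) * G2)" .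
  have "(\<Sum>s=1..<k. if idx \<pi> s = idx \<rho> s then 0 else c * (G (idx \<pi> s) + G (idx \<rho> s)))
      \<le> (\<Sum>s=1..<k. h (epoch_pos n s))"
  proof (rule sum_mono)
    fix s assume "s \<in> {1..<k}"
    show "(if idx \<pi> s = idx \<rho> s then 0 else c * (G (idx \<pi> s) + G (idx \<rho> s))) \<le> h (epoch_pos n s)"
      using cGs by (auto simp: h_def single_shuffle_def \<rho>_def Gs_def add.commute Transposition.transpose_def)
  qed
  also have "\<dots> \<le> N * (\<Sum>i=1..n. h i)"
    unfolding N_def using cGs by (intro sum_epoch_pos_le n) (simp add: h_def)
  also have "(\<Sum>i=1..n. h i) = 2 * (c * Gs)"
    using r j by (simp add: h_def sum.distrib)
  finally have "real k * norm (x \<rho> k - x \<pi> k) \<le> c * (2 * sqrt (real k + real n) * G2) + N * (2 * (c * Gs))"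
    using 1 iterate_stability[OF \<pi> \<rho> k, folded c_def] by linarith
  also have "\<dots> = c * (2 * sqrt (real k + real n) * G2 + 2 * N * Gs)"
    by (simp add: algebra_simps)
  finally show ?thesis
    using k unfolding c_def[symmetric] \<rho>_def[symmetric] N_def[symmetric] Gs_def[symmetric]
    by (simp add: pos_le_divide_eq mult.commute)
qed

section \<open>The sampling noise\<close>

text \<open>
  No term increases with \<open>k\<close>, as \<open>last_le_of_suffix_averages\<close> requires of the noise at the
  reference points.
\<close>

definition noise :: "nat \<Rightarrow> real" where
  "noise k = real m / \<mu> * (6 * (sqrt (real n) * G1 * G2 / real k) + 2 * (G1 * G2 / sqrt (real k))
     + 4 * (G2\<^sup>2 / real n))"

lemma G2_power2_le: "G2\<^sup>2 \<le> sqrt (real n) * G1 * G2"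
  using mult_right_mono[OF rms_G_le_sqrt_mean_G[OF n, of G] rms_G_nonneg[of n G]] G_pos
  by (simp add: power2_eq_square less_imp_le)

lemma G1_power2_le: "G1\<^sup>2 \<le> G2\<^sup>2"
  by (intro power_mono mean_G_le_rms_G n G1_nonneg)

lemma noise_nonneg: "noise k \<ge> 0"
  unfolding noise_def using m \<mu> G1_nonneg rms_G_nonneg[of n G]
  by (intro mult_nonneg_nonneg add_nonneg_nonneg divide_nonneg_nonneg) auto

lemma noise_antimono:
  assumes "t \<ge> 1"
  shows "noise (Suc t) \<le> noise t"
  unfolding noise_def using m n \<mu> G1_nonneg rms_G_nonneg[of n G] assms
  by (intro mult_left_mono add_mono divide_left_mono mult_nonneg_nonneg mult_pos_pos) auto

text \<open>
  Averaging the swap estimate over \<open>j\<close> and \<open>\<pi>\<close> produces \<open>G1 G2 \<surd>(k + n)\<close> from the common steps and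
  \<open>(k + n) / n (G1\<^sup>2 + G2\<^sup>2)\<close> from the exchanged positions. The part \<open>G2\<^sup>2\<close> of the latter that does not
  grow with \<open>k\<close> is at most \<open>\<surd>n G1 G2\<close>.
\<close>

lemma noise_bound:
  assumes r: "r \<in> {1..n}" and k: "1 \<le> k" "k \<le> Suc T"
  shows "\<bar>perm_mean n (\<lambda>\<pi>. f_mean (x \<pi> k) - f (\<pi> r) (x \<pi> k))\<bar> \<le> noise k"
proof -
  define c where "c = real m / \<mu>"
  define A where "A = 2 * sqrt (real k + real n) * G2"
  define B where "B = 2 * ((real k + real n) / real n)"
  have c: "c > 0" using m \<mu> by (simp add: c_def)
  have "\<bar>perm_mean n (\<lambda>\<pi>. f_mean (x \<pi> k) - f (\<pi> r) (x \<pi> k))\<bar>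
      \<le> perm_mean n (\<lambda>\<pi>. 1 / real n *
          (\<Sum>j=1..n. G (\<pi> r) * norm (x (\<pi> \<circ> Transposition.transpose r j) k - x \<pi> k)))"
    unfolding f_mean_def by (rule perm_mean_swap_noise[OF r f_lipschitz]) (auto intro: iterate_in k)
  also have "\<dots> \<le> perm_mean n (\<lambda>\<pi>. c / real k * ((A + B * G1) * G (\<pi> r) + B * (G (\<pi> r))\<^sup>2))"
  proof (rule perm_mean_mono)
    fix \<pi> assume \<pi>: "\<pi> permutes {1..n}"
    then have Gr: "G (\<pi> r) > 0" using permutes_in_image[OF \<pi>] r by (intro G_pos) auto
    have "(\<Sum>j=1..n. G (\<pi> r) * norm (x (\<pi> \<circ> Transposition.transpose r j) k - x \<pi> k))
        \<le> (\<Sum>j=1..n. G (\<pi> r) * (c * (A + B * (G (\<pi> r) + G (\<pi> j))) / real k))"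
      using swap_stability[OF \<pi> r _ k] Gr unfolding c_def A_def B_def
      by (intro sum_mono mult_left_mono) auto
    also have "\<dots> = (\<Sum>j=1..n. G (\<pi> r) * c / real k * (A + B * G (\<pi> r)) + G (\<pi> r) * c / real k * B * G (\<pi> j))"
      by (intro sum.cong refl) (simp add: algebra_simps add_divide_distrib)
    also have "\<dots> = real n * (G (\<pi> r) * c / real k * (A + B * G (\<pi> r)))
        + G (\<pi> r) * c / real k * B * (\<Sum>j=1..n. G (\<pi> j))"
      by (simp add: sum.distrib sum_distrib_left)
    also have "(\<Sum>j=1..n. G (\<pi> j)) = real n * G1"
      using n sum_perm[OF \<pi>, of G] by (simp only: mean_G_def) simp
    also have "real n * (G (\<pi> r) * c / real k * (A + B * G (\<pi> r)))
        + G (\<pi> r) * c / real k * B * (real n * G1)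
        = real n * (c / real k * ((A + B * G1) * G (\<pi> r) + B * (G (\<pi> r))\<^sup>2))"
      by (simp add: algebra_simps power2_eq_square add_divide_distrib)
    finally have "(\<Sum>j=1..n. G (\<pi> r) * norm (x (\<pi> \<circ> Transposition.transpose r j) k - x \<pi> k))
        \<le> real n * (c / real k * ((A + B * G1) * G (\<pi> r) + B * (G (\<pi> r))\<^sup>2))" .
    moreover have "1 / real n * S \<le> R" if "S \<le> real n * R" for S R
      using n that by (simp add: pos_divide_le_eq mult.commute)
    ultimately show "1 / real n * (\<Sum>j=1..n. G (\<pi> r) * norm (x (\<pi> \<circ> Transposition.transpose r j) k - x \<pi> k))
        \<le> c / real k * ((A + B * G1) * G (\<pi> r) + B * (G (\<pi> r))\<^sup>2)"
      by blast
  qed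
  also have "\<dots> = c / real k * ((A + B * G1) * G1 + B * G2\<^sup>2)"
    unfolding perm_mean_cmult perm_mean_add perm_mean_at[OF r, of G]
      perm_mean_at[OF r, of "\<lambda>i. (G i)\<^sup>2"] rms_G_power2[OF n] by (simp add: mean_G_def)
  also have "\<dots> \<le> noise k"
  proof -
    have B: "B = 2 * real k / real n + 2" "B \<ge> 0" using n by (simp_all add: B_def field_simps)
    have s: "sqrt (real k + real n) \<le> sqrt (real k) + sqrt (real n)"
      by (rule sqrt_add_le_add_sqrt) auto
    have "A * G1 \<le> 2 * (sqrt (real k) + sqrt (real n)) * G2 * G1"
      unfolding A_def using s G1_nonneg rms_G_nonneg[of n G] by (intro mult_right_mono) auto
    also have "\<dots> = 2 * (sqrt (real k) * (G1 * G2)) + 2 * (sqrt (real n) * G1 * G2)"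
      by (simp add: algebra_simps)
    finally have "A * G1 \<le> \<dots>" .
    moreover have "B * G1\<^sup>2 \<le> B * G2\<^sup>2" by (intro mult_left_mono G1_power2_le B)
    moreover have "B * G2\<^sup>2 = 2 * (real k * (G2\<^sup>2 / real n)) + 2 * G2\<^sup>2"
      unfolding B(1) by (simp add: algebra_simps)
    moreover have "(A + B * G1) * G1 = A * G1 + B * G1\<^sup>2"
      by (simp add: algebra_simps power2_eq_square)
    moreover have "s + b \<le> 6 * X + 2 * Y + 4 * Z"
      if "a \<le> 2 * Y + 2 * X" "b' \<le> b" "b = 2 * Z + 2 * g" "s = a + b'" "g \<le> X" for a b b' g s X Y Z :: real
      using that by linarith
    ultimately have "(A + B * G1) * G1 + B * G2\<^sup>2
        \<le> 6 * (sqrt (real n) * G1 * G2) + 2 * (sqrt (real k) * (G1 * G2)) + 4 * (real k * (G2\<^sup>2 / real n))"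
      using G2_power2_le by blast
    then have "c / real k * ((A + B * G1) * G1 + B * G2\<^sup>2) \<le> c / real k *
        (6 * (sqrt (real n) * G1 * G2) + 2 * (sqrt (real k) * (G1 * G2)) + 4 * (real k * (G2\<^sup>2 / real n)))"
      using c by (intro mult_left_mono) auto
    also have "\<dots> = c * (6 * (sqrt (real n) * G1 * G2 / real k) + 2 * (sqrt (real k) / real k * (G1 * G2))
        + 4 * (G2\<^sup>2 / real n))"
      using k n by (simp add: field_simps)
    also have "sqrt (real k) / real k = 1 / sqrt (real k)"
      using k by (simp add: sqrt_divide_self_eq inverse_eq_divide)
    finally show ?thesis by (simp add: noise_def c_def)
  qed
  finally show ?thesis .
qed

lemma noise_at_point:
  assumes "r \<in> {1..n}"
  shows "perm_mean n (\<lambda>\<pi>. f_mean z - f (\<pi> r) z) = 0"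
  using perm_mean_at[OF assms, of "\<lambda>i. f i z"]
  by (simp add: perm_mean_diff perm_mean_const f_mean_def)

section \<open>Weighted descent\<close>

text \<open>
  The solution of the recurrence \<open>(t + 1) w\<^bsub>t+1\<^esub> = (t + m) w\<^sub>t\<close> that makes the weighted squared distances
  telescope.
\<close>

definition w :: "nat \<Rightarrow> real" where "w t = real ((m + t - 1) choose t)"

lemma w_pos: "w t > 0"
  unfolding w_def using m by (simp add: zero_less_binomial_iff)

lemma w_Suc: "(real t + 1) * w (Suc t) = (real t + real m) * w t"
proof -
  have "m + t - 1 = t + (m - 1)" "m + Suc t - 1 = Suc (t + (m - 1))" using m by auto
  moreover have "Suc t * (Suc (t + (m - 1)) choose Suc t) = Suc (t + (m - 1)) * (t + (m - 1) choose t)"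
    using Suc_times_binomial_eq[of "t + (m - 1)" t] by (simp only: mult.commute)
  ultimately have "real (Suc t) * w (Suc t) = real (Suc (t + (m - 1))) * w t"
    unfolding w_def of_nat_mult[symmetric] by (simp only:)
  then show ?thesis using m by (simp add: of_nat_diff algebra_simps)
qed

lemma w_mono: "s \<le> t \<Longrightarrow> w s \<le> w t"
proof (rule lift_Suc_mono_le[of w])
  fix t
  have "(real t + 1) * w t \<le> (real t + real m) * w t"
    using m w_pos[of t] by (intro mult_right_mono) auto
  also have "\<dots> = (real t + 1) * w (Suc t)" by (rule w_Suc[symmetric])
  finally show "w t \<le> w (Suc t)" by (simp add: mult_le_cancel_left)
qed

lemma sum_w: "(\<Sum>t=1..T. w t) = real ((m + T) choose m) - 1"
proof -
  have "(\<Sum>t\<le>T. w t) = real (\<Sum>t\<le>T. (m - 1 + t) choose t)"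
    unfolding w_def of_nat_sum using m by (intro sum.cong) auto
  also have "(\<Sum>t\<le>T. (m - 1 + t) choose t) = Suc (m - 1 + T) choose T"
    by (rule sum_choose_lower)
  also have "Suc (m - 1 + T) choose T = (m + T) choose m"
    using m binomial_symmetric[of T "m + T"] by simp
  finally show ?thesis
    by (simp add: atMost_atLeast0 sum.atLeast_Suc_atMost w_def)
qed

lemma iterate_descent:
  assumes \<pi>: "\<pi> permutes {1..n}" and t: "1 \<le> t" "t \<le> T" and y: "y \<in> D"
  shows "w t * (F (x \<pi> (Suc t)) - F y) \<le>
    w t * ((f_mean (x \<pi> t) - f (idx \<pi> t) (x \<pi> t)) - (f_mean y - f (idx \<pi> t) y)
      + \<eta> t * (G1\<^sup>2 + (G (idx \<pi> t))\<^sup>2))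
    + (\<mu> / (2 * real m) * (real t * w t) * (norm (y - x \<pi> t))\<^sup>2
       - \<mu> / (2 * real m) * (real (Suc t) * w (Suc t)) * (norm (y - x \<pi> (Suc t)))\<^sup>2)"
proof -
  let ?a = "(norm (y - x \<pi> t))\<^sup>2" and ?b = "(norm (y - x \<pi> (Suc t)))\<^sup>2"
  have D: "x \<pi> t \<in> D" "x \<pi> (Suc t) \<in> D" using iterate_in \<pi> t by auto
  have i: "idx \<pi> t \<in> {1..n}" using idx_in \<pi> t by auto
  have "F (x \<pi> (Suc t)) - F y \<le> (f_mean (x \<pi> t) - f (idx \<pi> t) (x \<pi> t)) - (f_mean y - f (idx \<pi> t) y)
      + (?a / (2 * \<eta> t) - (1 / \<eta> t + \<mu>) / 2 * ?b) + \<eta> t / 2 * (G1 + G (idx \<pi> t))\<^sup>2"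
    unfolding F_def
    by (rule prox_descent[OF stepsize_pos[OF t(1)] iterate_opt[OF \<pi> t y]
          grad_ineq[OF i D_subset[OF D(1)] D_subset[OF y]] grad_bound[OF i D(1)]
          f_mean_lipschitz[OF D(2) D(1)]])
  also have "\<eta> t / 2 * (G1 + G (idx \<pi> t))\<^sup>2 \<le> \<eta> t / 2 * (2 * (G1\<^sup>2 + (G (idx \<pi> t))\<^sup>2))"
    using stepsize_pos[OF t(1)] sum_squares_bound[of G1 "G (idx \<pi> t)"]
    by (intro mult_left_mono) (auto simp: power2_sum)
  also have "\<eta> t / 2 * (2 * (G1\<^sup>2 + (G (idx \<pi> t))\<^sup>2)) = \<eta> t * (G1\<^sup>2 + (G (idx \<pi> t))\<^sup>2)"
    by (metis mult.assoc nonzero_eq_divide_eq zero_neq_numeral)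
  finally have "F (x \<pi> (Suc t)) - F y \<le> (f_mean (x \<pi> t) - f (idx \<pi> t) (x \<pi> t)) - (f_mean y - f (idx \<pi> t) y)
      + \<eta> t * (G1\<^sup>2 + (G (idx \<pi> t))\<^sup>2) + (?a / (2 * \<eta> t) - (1 / \<eta> t + \<mu>) / 2 * ?b)"
    by linarith
  then have "w t * (F (x \<pi> (Suc t)) - F y) \<le> w t * (((f_mean (x \<pi> t) - f (idx \<pi> t) (x \<pi> t))
      - (f_mean y - f (idx \<pi> t) y) + \<eta> t * (G1\<^sup>2 + (G (idx \<pi> t))\<^sup>2))
      + (?a / (2 * \<eta> t) - (1 / \<eta> t + \<mu>) / 2 * ?b))"
    using w_pos[of t] by (intro mult_left_mono) auto
  moreover have "w t * (?a / (2 * \<eta> t) - (1 / \<eta> t + \<mu>) / 2 * ?b)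
      = \<mu> / (2 * real m) * (real t * w t) * ?a - \<mu> / (2 * real m) * ((real t + real m) * w t) * ?b"
    using m \<mu> t by (simp add: field_simps)
  moreover have "(real t + real m) * w t = real (Suc t) * w (Suc t)"
    using w_Suc[of t] by (simp add: add.commute)
  ultimately show ?thesis unfolding distrib_left[of "w t"] by simp
qed

text \<open>
  Reference points depending on the permutation are needed for \<open>y = x\<^sub>k\<close>; the bound \<open>e\<close> on their noise
  has to hold at every position \<open>r\<close>, since a suffix may visit them all.
\<close>

lemma mean_descent:
  assumes k: "1 \<le> k" "k \<le> T" and y: "\<And>\<pi>. \<pi> permutes {1..n} \<Longrightarrow> y \<pi> \<in> D"
    and e: "\<And>r. r \<in> {1..n} \<Longrightarrow> \<bar>perm_mean n (\<lambda>\<pi>. f_mean (y \<pi>) - f (\<pi> r) (y \<pi>))\<bar> \<le> e"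
  shows "(\<Sum>t=k..T. w t * perm_mean n (\<lambda>\<pi>. F (x \<pi> (Suc t)) - F (y \<pi>)))
    \<le> \<mu> / (2 * real m) * (real k * w k) * perm_mean n (\<lambda>\<pi>. (norm (y \<pi> - x \<pi> k))\<^sup>2)
      + (\<Sum>t=k..T. w t * (noise t + 2 * \<eta> t * G2\<^sup>2 + e))"
proof -
  define V where "V t = \<mu> / (2 * real m) * (real t * w t) * perm_mean n (\<lambda>\<pi>. (norm (y \<pi> - x \<pi> t))\<^sup>2)" for t
  have V0: "V t \<ge> 0" for t
  proof -
    have "perm_mean n (\<lambda>\<pi>. (norm (y \<pi> - x \<pi> t))\<^sup>2) \<ge> 0"
      by (simp add: perm_mean_def sum_nonneg)
    then show ?thesis unfolding V_def using \<mu> w_pos[of t] by simp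
  qed
  have "w t * perm_mean n (\<lambda>\<pi>. F (x \<pi> (Suc t)) - F (y \<pi>))
      \<le> w t * (noise t + 2 * \<eta> t * G2\<^sup>2 + e) + (V t - V (Suc t))" if t: "t \<in> {k..T}" for t
  proof -
    have t1: "1 \<le> t" "t \<le> T" "t \<le> Suc T" using t k by auto
    define r where "r = epoch_pos n t"
    have r: "r \<in> {1..n}" unfolding r_def by (rule epoch_pos_in[OF n t1(1)])
    have "w t * perm_mean n (\<lambda>\<pi>. F (x \<pi> (Suc t)) - F (y \<pi>))
        = perm_mean n (\<lambda>\<pi>. w t * (F (x \<pi> (Suc t)) - F (y \<pi>)))"
      by (simp add: perm_mean_cmult)
    also have "\<dots> \<le> perm_mean n (\<lambda>\<pi>. w t * ((f_mean (x \<pi> t) - f (\<pi> r) (x \<pi> t))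
        - (f_mean (y \<pi>) - f (\<pi> r) (y \<pi>)) + \<eta> t * (G1\<^sup>2 + (G (\<pi> r))\<^sup>2))
        + (\<mu> / (2 * real m) * (real t * w t) * (norm (y \<pi> - x \<pi> t))\<^sup>2
           - \<mu> / (2 * real m) * (real (Suc t) * w (Suc t)) * (norm (y \<pi> - x \<pi> (Suc t)))\<^sup>2))"
      using iterate_descent[OF _ t1(1,2) y] unfolding single_shuffle_def r_def
      by (intro perm_mean_mono)
    also have "\<dots> = w t * (perm_mean n (\<lambda>\<pi>. f_mean (x \<pi> t) - f (\<pi> r) (x \<pi> t))
        - perm_mean n (\<lambda>\<pi>. f_mean (y \<pi>) - f (\<pi> r) (y \<pi>))
        + \<eta> t * (G1\<^sup>2 + perm_mean n (\<lambda>\<pi>. (G (\<pi> r))\<^sup>2))) + (V t - V (Suc t))"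
      by (simp only: perm_mean_add perm_mean_diff perm_mean_cmult perm_mean_const V_def)
    also have "perm_mean n (\<lambda>\<pi>. (G (\<pi> r))\<^sup>2) = G2\<^sup>2"
      using perm_mean_at[OF r, of "\<lambda>i. (G i)\<^sup>2"] n by (simp add: rms_G_power2)
    also have "w t * (perm_mean n (\<lambda>\<pi>. f_mean (x \<pi> t) - f (\<pi> r) (x \<pi> t))
        - perm_mean n (\<lambda>\<pi>. f_mean (y \<pi>) - f (\<pi> r) (y \<pi>)) + \<eta> t * (G1\<^sup>2 + G2\<^sup>2))
        \<le> w t * (noise t + 2 * \<eta> t * G2\<^sup>2 + e)"
    proof -
      have "\<eta> t * (G1\<^sup>2 + G2\<^sup>2) \<le> \<eta> t * (G2\<^sup>2 + G2\<^sup>2)"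
        using stepsize_pos[OF t1(1)] G1_power2_le by (intro mult_left_mono) auto
      also have "\<dots> = 2 * \<eta> t * G2\<^sup>2" by simp
      finally show ?thesis
        using noise_bound[OF r t1(1,3)] e[OF r] w_pos[of t] by (intro mult_left_mono) linarith+
    qed
    finally show ?thesis by simp
  qed
  then have "(\<Sum>t=k..T. w t * perm_mean n (\<lambda>\<pi>. F (x \<pi> (Suc t)) - F (y \<pi>)))
      \<le> (\<Sum>t=k..T. w t * (noise t + 2 * \<eta> t * G2\<^sup>2 + e) + (V t - V (Suc t)))"
    by (rule sum_mono)
  also have "\<dots> = (\<Sum>t=k..T. w t * (noise t + 2 * \<eta> t * G2\<^sup>2 + e)) + (V k - V (Suc T))"
    using sum_Suc_diff[of k T "\<lambda>t. - V t"] k by (simp add: sum.distrib)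
  finally show ?thesis using V0[of "Suc T"] unfolding V_def by linarith
qed

text \<open>
  The error of step \<open>t\<close>, together with the noise of the reference point \<open>x\<^sub>t\<close>, is at most \<open>m / \<mu>\<close> times
  \<open>14 \<surd>n G1 G2 / t + 4 G1 G2 / \<surd>t + 8 G2\<^sup>2 / n\<close>. Summation with the weights \<open>1 / (T + 1 - t)\<close> at most doubles
  the first two coefficients, up to the factor \<open>1 + ln T\<close>; hence the constant \<open>28\<close>.
\<close>

lemma last_iterate_bound:
  assumes z: "z \<in> D"
  shows "perm_mean n (\<lambda>\<pi>. F (x \<pi> (Suc T)) - F z) \<le>
    28 * (\<mu> * (norm (z - x1))\<^sup>2 / real ((m + T) choose m)
      + real m * (1 + ln (real T)) / \<mu> *
        (sqrt (real n) * G1 * G2 / real T + G1 * G2 / sqrt (real T) + G2\<^sup>2 / real n))"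
proof -
  define c where "c = real m / \<mu>"
  define P where "P = \<mu> / 2 * (norm (z - x1))\<^sup>2"
  define K where "K = real ((m + T) choose m)"
  define b where "b t = noise t + 2 * \<eta> t * G2\<^sup>2" for t
  define X where "X = sqrt (real n) * G1 * G2"
  define Y where "Y = G1 * G2"
  define Z where "Z = G2\<^sup>2 / real n"
  define L where "L = 1 + ln (real T)"
  have nonneg: "c \<ge> 0" "X \<ge> 0" "Y \<ge> 0" "Z \<ge> 0" "L \<ge> 0"
    using m \<mu> G1_nonneg rms_G_nonneg[of n G] T
    by (auto simp: c_def X_def Y_def Z_def L_def)
  have xs: "x \<pi> 1 = x1" if "\<pi> permutes {1..n}" for \<pi>
    using iterates[OF that] by (simp add: prox_gradient_iterates_def)
  have b0: "b t \<ge> 0" if "t \<ge> 1" for t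
    unfolding b_def using noise_nonneg[of t] stepsize_pos[OF that]
    by (intro add_nonneg_nonneg mult_nonneg_nonneg) auto
  have w1: "w 1 = real m" using m by (simp add: w_def)
  have first: "(\<Sum>t=1..T. w t * perm_mean n (\<lambda>\<pi>. F (x \<pi> (Suc t)) - F z)) \<le> P + (\<Sum>t=1..T. w t * b t)"
  proof -
    have "perm_mean n (\<lambda>\<pi>. (norm (z - x \<pi> 1))\<^sup>2) = perm_mean n (\<lambda>_. (norm (z - x1))\<^sup>2)"
      by (rule perm_mean_cong) (simp only: xs)
    then have "\<mu> / (2 * real m) * (real 1 * w 1) * perm_mean n (\<lambda>\<pi>. (norm (z - x \<pi> 1))\<^sup>2) = P"
      using m unfolding w1 P_def perm_mean_const by simp
    then show ?thesis
      using mean_descent[OF order_refl T, of "\<lambda>_. z" 0] z noise_at_point by (simp add: b_def)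
  qed
  have suffix: "(\<Sum>t=k..T. w t * (perm_mean n (\<lambda>\<pi>. F (x \<pi> (Suc t)) - F z)
      - perm_mean n (\<lambda>\<pi>. F (x \<pi> k) - F z))) \<le> (\<Sum>t=k..T. w t * (b t + noise k))"
    if k: "2 \<le> k" "k \<le> T" for k
  proof -
    have "perm_mean n (\<lambda>\<pi>. F (x \<pi> (Suc t)) - F z) - perm_mean n (\<lambda>\<pi>. F (x \<pi> k) - F z)
        = perm_mean n (\<lambda>\<pi>. F (x \<pi> (Suc t)) - F (x \<pi> k))" for t
      by (simp add: perm_mean_diff)
    then show ?thesis
      using mean_descent[of k "\<lambda>\<pi>. x \<pi> k" "noise k"] k noise_bound[of _ k] iterate_in[of _ k]
      by (simp add: b_def perm_mean_const)
  qed
  have "perm_mean n (\<lambda>\<pi>. F (x \<pi> (Suc T)) - F z)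
      \<le> P / (\<Sum>t=1..T. w t) + (\<Sum>t=1..T. (b t + noise t) / real (T + 1 - t))"
    by (rule last_le_of_suffix_averages[where \<Delta> = "\<lambda>t. perm_mean n (\<lambda>\<pi>. F (x \<pi> t) - F z)"])
      (use T w_pos w_mono b0 noise_nonneg noise_antimono first suffix in auto)
  also have "P / (\<Sum>t=1..T. w t) \<le> 28 * (\<mu> * (norm (z - x1))\<^sup>2 / K)"
  proof -
    have "w 1 \<le> (\<Sum>t=1..T. w t)"
      using T w_pos by (intro member_le_sum) (auto intro: less_imp_le)
    then have K: "K - 1 \<ge> 1" "(\<Sum>t=1..T. w t) = K - 1"
      using m unfolding w1 sum_w K_def by auto
    \<comment> \<open>The sum of the weights misses the binomial coefficient by \<open>1\<close>, which halves it at worst.\<close>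
    have "P / (\<Sum>t=1..T. w t) \<le> P / (K / 2)"
      unfolding K(2) using K(1) \<mu> by (intro divide_left_mono) (auto simp: P_def)
    also have "\<dots> = 1 * (\<mu> * (norm (z - x1))\<^sup>2 / K)" by (simp add: P_def)
    also have "\<dots> \<le> 28 * (\<mu> * (norm (z - x1))\<^sup>2 / K)"
      using K(1) \<mu> by (intro mult_right_mono) auto
    finally show ?thesis .
  qed
  also have "(\<Sum>t=1..T. (b t + noise t) / real (T + 1 - t)) \<le> 28 * (c * L * (X / real T + Y / sqrt (real T) + Z))"
  proof -
    have "(b t + noise t) / real (T + 1 - t) \<le> c * (14 * X) * (1 / real t / real (T + 1 - t))
        + c * (4 * Y) * (1 / sqrt (real t) / real (T + 1 - t)) + c * (8 * Z) * (1 / real (T + 1 - t))"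
      if t: "t \<in> {1..T}" for t
    proof -
      have "2 * \<eta> t * G2\<^sup>2 \<le> 2 * \<eta> t * X"
        unfolding X_def using stepsize_pos[of t] t by (intro mult_left_mono G2_power2_le) auto
      also have "2 * \<eta> t * X = c * (2 * (X / real t))" by (simp add: c_def)
      finally have "b t + noise t \<le> 2 * noise t + c * (2 * (X / real t))"
        unfolding b_def by linarith
      also have "2 * noise t = 2 * (c * (6 * (X / real t) + 2 * (Y / sqrt (real t)) + 4 * Z))"
        by (simp add: noise_def c_def X_def Y_def Z_def)
      also have "2 * (c * (6 * (X / real t) + 2 * (Y / sqrt (real t)) + 4 * Z)) + c * (2 * (X / real t))
          = c * (14 * (X / real t) + 4 * (Y / sqrt (real t)) + 8 * Z)"
        by (simp add: algebra_simps)
      finally have "b t + noise t \<le> c * (14 * (X / real t) + 4 * (Y / sqrt (real t)) + 8 * Z)" .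
      then have "(b t + noise t) / real (T + 1 - t)
          \<le> c * (14 * (X / real t) + 4 * (Y / sqrt (real t)) + 8 * Z) / real (T + 1 - t)"
        by (rule divide_right_mono) simp
      also have "\<dots> = c * (14 * X) * (1 / real t / real (T + 1 - t))
        + c * (4 * Y) * (1 / sqrt (real t) / real (T + 1 - t)) + c * (8 * Z) * (1 / real (T + 1 - t))"
        by (simp add: add_divide_distrib distrib_left)
      finally show ?thesis .
    qed
    then have "(\<Sum>t=1..T. (b t + noise t) / real (T + 1 - t)) \<le> (\<Sum>t=1..T. c * (14 * X) * (1 / real t / real (T + 1 - t))
        + c * (4 * Y) * (1 / sqrt (real t) / real (T + 1 - t)) + c * (8 * Z) * (1 / real (T + 1 - t)))"
      by (rule sum_mono)
    also have "\<dots> = c * (14 * X) * (\<Sum>t=1..T. 1 / real t / real (T + 1 - t))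
        + c * (4 * Y) * (\<Sum>t=1..T. 1 / sqrt (real t) / real (T + 1 - t))
        + c * (8 * Z) * (\<Sum>t=1..T. 1 / real (T + 1 - t))"
      by (simp only: sum.distrib sum_distrib_left)
    also have "\<dots> \<le> c * (14 * X) * (2 * L / real T) + c * (4 * Y) * (2 * L / sqrt (real T)) + c * (8 * Z) * L"
      unfolding L_def sum_reverse_weights
      using nonneg by (intro add_mono mult_left_mono sum_inverse_weights sum_inverse_sqrt_weights harm_le_ln T) auto
    also have "\<dots> = c * L * (28 * (X / real T) + 8 * (Y / sqrt (real T)) + 8 * Z)"
      by (simp add: algebra_simps)
    also have "\<dots> \<le> c * L * (28 * (X / real T + Y / sqrt (real T) + Z))"
    proof -
      have "Y / sqrt (real T) \<ge> 0" using nonneg by simp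
      then have "28 * (X / real T) + 8 * (Y / sqrt (real T)) + 8 * Z \<le> 28 * (X / real T + Y / sqrt (real T) + Z)"
        using nonneg(4) unfolding distrib_left by linarith
      then show ?thesis using nonneg by (intro mult_left_mono) auto
    qed
    finally show ?thesis by (simp add: mult_ac)
  qed
  finally show ?thesis
    by (simp only: K_def c_def L_def X_def Y_def Z_def distrib_left[of "28::real"] times_divide_eq_left)
qed

end

theorem theoremA6:
  shows "\<exists>C>0. \<forall>(d::nat) (n::nat) (T::nat) (m::nat) (\<mu>::real)
    (f :: nat \<Rightarrow> fseq \<Rightarrow> real) (gf :: nat \<Rightarrow> fseq \<Rightarrow> fseq) (\<psi> :: fseq \<Rightarrow> ereal) (G :: nat \<Rightarrow> real)
    (x1 :: fseq) (x :: (nat \<Rightarrow> nat) \<Rightarrow> nat \<Rightarrow> fseq) (z :: fseq).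
    d \<ge> 1 \<longrightarrow> n \<ge> 1 \<longrightarrow> T \<ge> 1 \<longrightarrow> m \<ge> 1 \<longrightarrow> \<mu> > 0 \<longrightarrow>
    (\<forall>i\<in>{1..n}. convex_on (Rd d) (f i)) \<longrightarrow>
    proper_closed_convex (Rd d) \<psi> \<longrightarrow>
    strongly_convex (Rd d) \<mu> \<psi> \<longrightarrow>
    (\<forall>i\<in>{1..n}. \<forall>y\<in>Rd d. gf i y \<in> subdifferential (Rd d) (\<lambda>v. ereal (f i v)) y) \<longrightarrow>
    (\<forall>i\<in>{1..n}. G i > 0 \<and>
       lipschitz_with_gradient (G i) (effective_domain (Rd d) \<psi>) (f i) (gf i)) \<longrightarrow>
    x1 \<in> effective_domain (Rd d) \<psi> \<longrightarrow>
    (\<forall>\<pi>. \<pi> permutes {1..n} \<longrightarrow>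
       prox_gradient_iterates (Rd d) \<psi> gf (\<lambda>t. real m / (\<mu> * real t))
         (single_shuffle n \<pi>) T x1 (x \<pi>)) \<longrightarrow>
    z \<in> Rd d \<longrightarrow>
    ereal_expectation (random_permutation n)
      (\<lambda>\<pi>. objective n f \<psi> (x \<pi> (T + 1)) - objective n f \<psi> z)
    \<le> ereal (C *
        (\<mu> * (norm (z - x1))\<^sup>2 / real ((m + T) choose m)
         + real m * (1 + ln (real T)) / \<mu> *
           (sqrt (real n) * mean_G n G * rms_G n G / real T
            + mean_G n G * rms_G n G / sqrt (real T)
            + (rms_G n G)\<^sup>2 / real n)))"
proof (rule exI[of _ 28], intro conjI allI impI, goal_cases)
  case (2 d n T m \<mu> f gf \<psi> G x1 x z)
  interpret shuffled_prox "Rd d" n T m \<mu> f gf \<psi> G x1 x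
    using 2 by unfold_locales (auto intro: subspace_Rd)
  have X: "objective n f \<psi> (x \<pi> (T + 1)) = ereal (F (x \<pi> (T + 1)))" if "\<pi> permutes {1..n}" for \<pi>
    by (rule objective_eq) (use iterate_in[OF that, of "T + 1"] in simp)
  show ?case
  proof (cases "z \<in> D")
    case True
    have "ereal_expectation (random_permutation n)
        (\<lambda>\<pi>. objective n f \<psi> (x \<pi> (T + 1)) - objective n f \<psi> z)
        = ereal (perm_mean n (\<lambda>\<pi>. F (x \<pi> (T + 1)) - F z))"
      by (rule ereal_expectation_random_permutation) (simp only: X objective_eq[OF True] ereal_minus)
    then show ?thesis using last_iterate_bound[OF True] by simp
  next
    case False
    then have "objective n f \<psi> z = \<infinity>"
      using 2 by (simp add: objective_def effective_domain_def)
    then have "ereal_expectation (random_permutation n)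
        (\<lambda>\<pi>. objective n f \<psi> (x \<pi> (T + 1)) - objective n f \<psi> z) = -\<infinity>"
      by (intro ereal_expectation_random_permutation_MInf) (simp only: X, simp)
    then show ?thesis by simp
  qed
qed simp

end
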